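(* Let $n\geq 3$. An $A_n$-word $w$ is $n$-rotating if and only if there exist $b\geq 1$ and a sequence $(w_b,\ldots,w_1)$ of $A_{n-1}$-words such that $$w=\phi_n^{b-1}(w_b)\cdots\phi_n(w_2)\cdot w_1$$ and the following conditions hold: (i) for every $1\le k\le b$, the word $w_k$ is $(n-1)$-rotating; (ii) for every $3\leq k\le b$, the word $w_k$ ends with $a_{p-1,n-1}$ for some $p$; (iii) (if $b\ge2$) the word $w_2$ is either empty (which is not allowed when $b=2$) or ends with $a_{p-1,n-1}$ for some $p$; (iv) for every $3\leq k\le b$, if the word $w_k$ ends with $a_{p-1,n-1}$ with $p\neq n-1$, then the word $w_{k-1}$ contains an $a_{p,n}$-barrier.
   Context: For $n\geq 2$ let $A_n=\{a_{p,q}\mid 1\leq p<q\leq n\}$. The dual braid monoid $B_n^{+*}$ is the monoid presented by generators $A_n$ and relations: $a_{p,q}a_{r,s}=a_{r,s}a_{p,q}$ whenever $[p,q]$ and $[r,s]$ are disjoint or nested (nested means $r<p<q<s$ or $p<r<s<q$), and $a_{p,q}a_{q,r}=a_{q,r}a_{p,r}=a_{p,r}a_{p,q}$ for $1\leq p<q<r\leq n$. Its elements are called braids; $B_{n-1}^{+*}$ is identified with the submonoid of $B_n^{+*}$ generated by $A_{n-1}$. An $A_n$-word is a word on $A_n$; $\varepsilon$ is the empty word. The automorphism $\phi_n$ of $B_n^{+*}$ is given by $\phi_n(a_{p,q})=a_{p+1,q+1}$ for $q\leq n-1$ and $\phi_n(a_{p,n})=a_{1,p+1}$; it is applied letterwise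 to words. A braid $\gamma$ is a right-divisor of $\beta$ if $\beta=\beta'\gamma$ for some $\beta'\in B_n^{+*}$. For $n\geq 3$, the $B_{n-1}^{+*}$-tail of $\beta\in B_n^{+*}$ is the maximal right-divisor of $\beta$ lying in $B_{n-1}^{+*}$. For $n\geq3$ and $\beta\in B_n^{+*}$ nontrivial there is (known) a unique sequence $(\beta_b,\ldots,\beta_1)$ in $B_{n-1}^{+*}$, the $\phi_n$-splitting of $\beta$, with $\beta_b\neq 1$, $\beta=\phi_n^{b-1}(\beta_b)\cdots\phi_n(\beta_2)\,\beta_1$, and such that for $1\le k<b$ the $B_{n-1}^{+*}$-tail of $\phi_n^{b-k}(\beta_b)\cdots\phi_n(\beta_{k+1})$ is trivial. Rotating normal form: $r_2(\beta)$ is the unique word $a_{1,2}^k$ representing $\beta\in B_2^{+*}$; for $n\geq3$, $r_n(1)=\varepsilon$ and for nontrivial $\beta$ with splitting $(\beta_b,\ldots,\beta_1)$, $r_n(\beta)=\phi_n^{b-1}(r_{n-1}(\beta_b))\cdots\phi_n(r_{n-1}(\beta_2))\cdot r_{n-1}(\beta_1)$. An $A_n$-word is $n$-rotating if it equals $r_n(\beta)$ for some $\beta\in B_n^{+*}$. A letter $a_{r,s}$ is an $a_{p,n}$-barrier if $1\leq r<p<s\leq n-1$; a word contains an $a_{p,n}$-barrier if one of its letters is an $a_{p,n}$-barrier. *)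

theory Defs
  imports "HOL-Algebra.Group"
begin

text \<open>The pair \<open>(p, q)\<close> stands for the generator \<open>a\<^sub>p\<^sub>,\<^sub>q\<close>.\<close>

type_synonym letter = "nat \<times> nat"
type_synonym word = "letter list"
type_synonym braid = "word set"

definition gens :: "nat \<Rightarrow> letter set" where
  "gens n = {(p, q). 1 \<le> p \<and> p < q \<and> q \<le> n}"

inductive dual_rel :: "nat \<Rightarrow> word \<Rightarrow> word \<Rightarrow> bool" for n :: nat where
  disjoint: "\<lbrakk>(p, q) \<in> gens n; (r, s) \<in> gens n; q < r \<or> s < p\<rbrakk>
    \<Longrightarrow> dual_rel n [(p, q), (r, s)] [(r, s), (p, q)]"
| nested: "\<lbrakk>(p, q) \<in> gens n; (r, s) \<in> gens n; (r < p \<and> q < s) \<or> (p < r \<and> s < q)\<rbrakk>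
    \<Longrightarrow> dual_rel n [(p, q), (r, s)] [(r, s), (p, q)]"
| triangle1: "\<lbrakk>1 \<le> p; p < q; q < r; r \<le> n\<rbrakk>
    \<Longrightarrow> dual_rel n [(p, q), (q, r)] [(q, r), (p, r)]"
| triangle2: "\<lbrakk>1 \<le> p; p < q; q < r; r \<le> n\<rbrakk>
    \<Longrightarrow> dual_rel n [(q, r), (p, r)] [(p, r), (p, q)]"

inductive dual_cong :: "nat \<Rightarrow> word \<Rightarrow> word \<Rightarrow> bool" for n :: nat where
  step: "\<lbrakk>x \<in> lists (gens n); y \<in> lists (gens n); dual_rel n u v\<rbrakk>
    \<Longrightarrow> dual_cong n (x @ u @ y) (x @ v @ y)"
| refl: "u \<in> lists (gens n) \<Longrightarrow> dual_cong n u u"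
| sym: "dual_cong n u v \<Longrightarrow> dual_cong n v u"
| trans: "\<lbrakk>dual_cong n u v; dual_cong n v w\<rbrakk> \<Longrightarrow> dual_cong n u w"

definition braid_of :: "nat \<Rightarrow> word \<Rightarrow> braid" where
  "braid_of n w = {v. dual_cong n w v}"

text \<open>Braids are congruence classes of words. Both sides of each relation involve the same strand
  indices, so the class of a word on \<open>gens m\<close> is the same set of words for every \<open>n \<ge> m\<close>. Hence
  the identification of the monoid on \<open>m\<close> strands with a submonoid of the one on \<open>n\<close> strands is
  literal inclusion of carriers; see \<open>dual_braid_monoid_submonoid\<close> below.\<close>

definition dual_braid_monoid :: "nat \<Rightarrow> braid monoid" where
  "dual_braid_monoid n =
    \<lparr>carrier = braid_of n ` lists (gens n),
     mult = (\<lambda>X Y. \<Union>u\<in>X. \<Union>v\<in>Y. braid_of n (u @ v)),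
     one = braid_of n []\<rparr>"

definition phi_letter :: "nat \<Rightarrow> letter \<Rightarrow> letter" where
  "phi_letter n = (\<lambda>(p, q). if q = n then (1, p + 1) else (p + 1, q + 1))"

definition phi_word :: "nat \<Rightarrow> word \<Rightarrow> word" where
  "phi_word n = map (phi_letter n)"

definition phi_braid :: "nat \<Rightarrow> braid \<Rightarrow> braid" where
  "phi_braid n X = (\<Union>w\<in>X. braid_of n (phi_word n w))"

definition right_divisor :: "nat \<Rightarrow> braid \<Rightarrow> braid \<Rightarrow> bool" where
  "right_divisor n \<gamma> \<beta> \<longleftrightarrow>
    (\<exists>\<beta>'\<in>carrier (dual_braid_monoid n). \<beta> = \<beta>' \<otimes>\<^bsub>dual_braid_monoid n\<^esub> \<gamma>)"

text \<open>\<open>is_tail n \<gamma> \<beta>\<close>: the tail of \<open>\<beta>\<close> with respect to the monoid on \<open>n - 1\<close> strands is \<open>\<gamma>\<close>;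
  maximality refers to right-divisibility.\<close>

definition is_tail :: "nat \<Rightarrow> braid \<Rightarrow> braid \<Rightarrow> bool" where
  "is_tail n \<gamma> \<beta> \<longleftrightarrow>
    \<gamma> \<in> carrier (dual_braid_monoid (n - 1)) \<and> right_divisor n \<gamma> \<beta> \<and>
    (\<forall>\<delta>\<in>carrier (dual_braid_monoid (n - 1)). right_divisor n \<delta> \<beta> \<longrightarrow> right_divisor n \<delta> \<gamma>)"

text \<open>A sequence \<open>(x\<^sub>b, \<dots>, x\<^sub>1)\<close> is the list \<open>[x\<^sub>b, \<dots>, x\<^sub>1]\<close>; \<open>entry xs k\<close> is \<open>x\<^sub>k\<close>, counted from the
  right end starting at 1.\<close>

definition entry :: "'a list \<Rightarrow> nat \<Rightarrow> 'a" where
  "entry xs k = xs ! (length xs - k)"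

definition braid_prod :: "nat \<Rightarrow> braid list \<Rightarrow> braid" where
  "braid_prod n Xs = foldr (mult (dual_braid_monoid n)) Xs \<one>\<^bsub>dual_braid_monoid n\<^esub>"

definition is_splitting :: "nat \<Rightarrow> braid \<Rightarrow> braid list \<Rightarrow> bool" where
  "is_splitting n \<beta> \<beta>s \<longleftrightarrow>
    (let b = length \<beta>s in
      1 \<le> b \<and> set \<beta>s \<subseteq> carrier (dual_braid_monoid (n - 1)) \<and>
      entry \<beta>s b \<noteq> \<one>\<^bsub>dual_braid_monoid n\<^esub> \<and>
      \<beta> = braid_prod n (map (\<lambda>k. (phi_braid n ^^ (k - 1)) (entry \<beta>s k)) (rev [1..<b + 1])) \<and>
      (\<forall>k. 1 \<le> k \<and> k < b \<longrightarrow>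
        is_tail n \<one>\<^bsub>dual_braid_monoid n\<^esub>
          (braid_prod n (map (\<lambda>j. (phi_braid n ^^ (j - k)) (entry \<beta>s j)) (rev [k + 1..<b + 1])))))"

definition splitting :: "nat \<Rightarrow> braid \<Rightarrow> braid list" where
  "splitting n \<beta> = (THE \<beta>s. is_splitting n \<beta> \<beta>s)"

definition phi_concat :: "nat \<Rightarrow> word list \<Rightarrow> word" where
  "phi_concat n ws =
    concat (map (\<lambda>k. (phi_word n ^^ (k - 1)) (entry ws k)) (rev [1..<length ws + 1]))"

text \<open>Only \<open>n \<ge> 2\<close> is meaningful: for \<open>n < 2\<close> the value of \<open>rnf\<close> is irrelevant.\<close>

function rnf :: "nat \<Rightarrow> braid \<Rightarrow> word" where
  "rnf n \<beta> =
    (if n \<le> 2 then (THE w. w \<in> \<beta> \<and> (\<exists>k. w = replicate k (1, 2)))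
     else if \<beta> = \<one>\<^bsub>dual_braid_monoid n\<^esub> then []
     else phi_concat n (map (\<lambda>\<gamma>. rnf (n - 1) \<gamma>) (splitting n \<beta>)))"
  by pat_completeness auto
termination by (relation "measure fst") auto

declare rnf.simps [simp del]

definition rotating :: "nat \<Rightarrow> word \<Rightarrow> bool" where
  "rotating n w \<longleftrightarrow> (\<exists>\<beta>\<in>carrier (dual_braid_monoid n). w = rnf n \<beta>)"

definition ends_with :: "word \<Rightarrow> letter \<Rightarrow> bool" where
  "ends_with w a \<longleftrightarrow> w \<noteq> [] \<and> last w = a"

definition is_barrier :: "nat \<Rightarrow> nat \<Rightarrow> letter \<Rightarrow> bool" where
  "is_barrier n p = (\<lambda>(r, s). 1 \<le> r \<and> r < p \<and> p < s \<and> s \<le> n - 1)"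

definition contains_barrier :: "nat \<Rightarrow> nat \<Rightarrow> word \<Rightarrow> bool" where
  "contains_barrier n p w \<longleftrightarrow> (\<exists>a\<in>set w. is_barrier n p a)"

declare in_listsD [rule del] in_listsI [rule del]

lemma gens_mono: "m \<le> n \<Longrightarrow> gens m \<subseteq> gens n"
  by (auto simp: gens_def)

lemma dual_rel_lists:
  assumes "dual_rel n u v"
  shows "u \<in> lists (gens n) \<and> v \<in> lists (gens n)"
  using assms by cases (auto simp: gens_def)

lemma dual_cong_lists:
  assumes "dual_cong n u v"
  shows "u \<in> lists (gens n) \<and> v \<in> lists (gens n)"
  using assms by induction (auto dest: dual_rel_lists)

lemma dual_cong_ctxt:
  assumes "dual_cong n u v" "x \<in> lists (gens n)" "y \<in> lists (gens n)"
  shows "dual_cong n (x @ u @ y) (x @ v @ y)"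
  using assms
proof induction
  case (step x' y' u v)
  then show ?case using dual_cong.step[of "x @ x'" n "y' @ y" u v] by simp
next
  case (trans u v w)
  then show ?case using dual_cong.trans by blast
next
  case (sym u v)
  then show ?case using dual_cong.sym by blast
qed (auto intro: dual_cong.refl)

lemma dual_cong_append:
  assumes "dual_cong n u u'" "dual_cong n v v'"
  shows "dual_cong n (u @ v) (u' @ v')"
proof (rule dual_cong.trans)
  show "dual_cong n (u @ v) (u' @ v)"
    using dual_cong_ctxt[OF assms(1), of "[]" v] dual_cong_lists[OF assms(2)] by simp
  show "dual_cong n (u' @ v) (u' @ v')"
    using dual_cong_ctxt[OF assms(2), of u' "[]"] dual_cong_lists[OF assms(1)] by simp
qed

lemma braid_of_eq_iff:
  assumes "u \<in> lists (gens n)"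
  shows "braid_of n u = braid_of n v \<longleftrightarrow> dual_cong n u v"
proof
  assume "braid_of n u = braid_of n v"
  moreover have "u \<in> braid_of n u"
    using dual_cong.refl[OF assms] by (simp add: braid_of_def)
  ultimately have "u \<in> braid_of n v"
    by blast
  then have "dual_cong n v u"
    by (simp add: braid_of_def)
  then show "dual_cong n u v"
    by (rule dual_cong.sym)
next
  assume uv: "dual_cong n u v"
  have "dual_cong n u x \<longleftrightarrow> dual_cong n v x" for x
    using dual_cong.trans[OF uv, of x] dual_cong.trans[OF dual_cong.sym[OF uv], of x] by blast
  then show "braid_of n u = braid_of n v"
    by (simp add: braid_of_def)
qed

lemma mult_braid_of:
  assumes "u \<in> lists (gens n)" "v \<in> lists (gens n)"
  shows "braid_of n u \<otimes>\<^bsub>dual_braid_monoid n\<^esub> braid_of n v = braid_of n (u @ v)"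
proof -
  have *: "braid_of n (u' @ v') = braid_of n (u @ v)"
    if "u' \<in> braid_of n u" "v' \<in> braid_of n v" for u' v'
  proof -
    have "dual_cong n (u @ v) (u' @ v')"
      using that dual_cong_append by (auto simp: braid_of_def)
    then show ?thesis
      using braid_of_eq_iff[of "u @ v" n "u' @ v'"] assms by auto
  qed
  have "u \<in> braid_of n u" "v \<in> braid_of n v"
    using assms by (auto simp: braid_of_def intro: dual_cong.refl)
  then have "(\<Union>u'\<in>braid_of n u. \<Union>v'\<in>braid_of n v. braid_of n (u' @ v')) = braid_of n (u @ v)"
    using * by blast
  then show ?thesis
    by (simp add: dual_braid_monoid_def)
qed

lemma carrier_dual_braid_monoid:
  "carrier (dual_braid_monoid n) = braid_of n ` lists (gens n)"
  by (simp add: dual_braid_monoid_def)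

lemma one_dual_braid_monoid: "\<one>\<^bsub>dual_braid_monoid n\<^esub> = braid_of n []"
  by (simp add: dual_braid_monoid_def)

lemma monoid_dual_braid_monoid: "monoid (dual_braid_monoid n)"
proof (rule monoidI)
  fix X Y assume "X \<in> carrier (dual_braid_monoid n)" "Y \<in> carrier (dual_braid_monoid n)"
  then show "X \<otimes>\<^bsub>dual_braid_monoid n\<^esub> Y \<in> carrier (dual_braid_monoid n)"
    by (auto simp: carrier_dual_braid_monoid mult_braid_of)
next
  fix X Y Z
  assume "X \<in> carrier (dual_braid_monoid n)" "Y \<in> carrier (dual_braid_monoid n)"
    "Z \<in> carrier (dual_braid_monoid n)"
  then obtain x y z where "X = braid_of n x" "Y = braid_of n y" "Z = braid_of n z"
    and l: "x \<in> lists (gens n)" "y \<in> lists (gens n)" "z \<in> lists (gens n)"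
    by (auto simp: carrier_dual_braid_monoid)
  moreover have "x @ y \<in> lists (gens n)" "y @ z \<in> lists (gens n)"
    using l by auto
  ultimately show "X \<otimes>\<^bsub>dual_braid_monoid n\<^esub> Y \<otimes>\<^bsub>dual_braid_monoid n\<^esub> Z =
      X \<otimes>\<^bsub>dual_braid_monoid n\<^esub> (Y \<otimes>\<^bsub>dual_braid_monoid n\<^esub> Z)"
    by (simp add: mult_braid_of)
qed (auto simp: carrier_dual_braid_monoid one_dual_braid_monoid mult_braid_of
)

lemma dual_rel_restrict:
  assumes "dual_rel n u v" "m \<le> n"
  shows "(u \<in> lists (gens m) \<longleftrightarrow> v \<in> lists (gens m)) \<and> (u \<in> lists (gens m) \<longrightarrow> dual_rel m u v)"
  using assms by cases (auto simp: gens_def intro: dual_rel.intros)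

lemma dual_cong_restrict:
  assumes "dual_cong n u v" "m \<le> n"
  shows "(u \<in> lists (gens m) \<longleftrightarrow> v \<in> lists (gens m)) \<and> (u \<in> lists (gens m) \<longrightarrow> dual_cong m u v)"
  using assms
proof induction
  case (step x y u v)
  then show ?case
    using dual_rel_restrict[of n u v m] dual_cong.step[of x m y u v] by auto
next
  case (trans u v w)
  then show ?case using dual_cong.trans by blast
next
  case (sym u v)
  then show ?case using dual_cong.sym by blast
qed (auto intro: dual_cong.refl)

lemma dual_rel_mono: "dual_rel m u v \<Longrightarrow> m \<le> n \<Longrightarrow> dual_rel n u v"
  by (induction rule: dual_rel.induct) (auto simp: gens_def intro: dual_rel.intros)

lemma dual_cong_mono:
  assumes "dual_cong m u v" "m \<le> n"
  shows "dual_cong n u v"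
  using assms
proof induction
  case (step x y u v)
  then show ?case
    using lists_mono[OF gens_mono[of m n]] dual_rel_mono[of m u v n] by (intro dual_cong.step) auto
next
  case (refl u)
  then show ?case using lists_mono[OF gens_mono[of m n]] by (intro dual_cong.refl) auto
next
  case (trans u v w)
  then show ?case using dual_cong.trans by blast
next
  case (sym u v)
  then show ?case using dual_cong.sym by blast
qed

lemma braid_of_restrict:
  assumes "w \<in> lists (gens m)" "m \<le> n"
  shows "braid_of n w = braid_of m w"
  using assms dual_cong_restrict[of n w _ m] dual_cong_mono[of m w _ n]
  unfolding braid_of_def by blast

lemma dual_braid_monoid_submonoid:
  assumes "m \<le> n"
  shows "carrier (dual_braid_monoid m) = braid_of n ` lists (gens m)"
    and "submonoid (carrier (dual_braid_monoid m)) (dual_braid_monoid n)"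
    and "\<lbrakk>X \<in> carrier (dual_braid_monoid m); Y \<in> carrier (dual_braid_monoid m)\<rbrakk>
      \<Longrightarrow> X \<otimes>\<^bsub>dual_braid_monoid m\<^esub> Y = X \<otimes>\<^bsub>dual_braid_monoid n\<^esub> Y"
    and "\<one>\<^bsub>dual_braid_monoid m\<^esub> = \<one>\<^bsub>dual_braid_monoid n\<^esub>"
proof -
  have sub: "u \<in> lists (gens n)" if "u \<in> lists (gens m)" for u
    using that lists_mono[OF gens_mono[OF assms]] by blast
  show c: "carrier (dual_braid_monoid m) = braid_of n ` lists (gens m)"
    using braid_of_restrict[OF _ assms] by (simp add: carrier_dual_braid_monoid)
  show o: "\<one>\<^bsub>dual_braid_monoid m\<^esub> = \<one>\<^bsub>dual_braid_monoid n\<^esub>"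
    using braid_of_restrict[OF _ assms, of "[]"] by (simp add: one_dual_braid_monoid)
  have m: "X \<otimes>\<^bsub>dual_braid_monoid m\<^esub> Y = X \<otimes>\<^bsub>dual_braid_monoid n\<^esub> Y"
    if XY: "X \<in> carrier (dual_braid_monoid m)" "Y \<in> carrier (dual_braid_monoid m)" for X Y
  proof -
    obtain u v where uv: "u \<in> lists (gens m)" "v \<in> lists (gens m)"
      "X = braid_of m u" "Y = braid_of m v"
      using XY unfolding carrier_dual_braid_monoid by blast
    have "u @ v \<in> lists (gens m)" using uv(1,2) by auto
    then show ?thesis
      using mult_braid_of[OF uv(1,2)] mult_braid_of[OF sub[OF uv(1)] sub[OF uv(2)]]
        braid_of_restrict[OF _ assms] uv by metis
  qed
  show "\<lbrakk>X \<in> carrier (dual_braid_monoid m); Y \<in> carrier (dual_braid_monoid m)\<rbrakk>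
      \<Longrightarrow> X \<otimes>\<^bsub>dual_braid_monoid m\<^esub> Y = X \<otimes>\<^bsub>dual_braid_monoid n\<^esub> Y"
    by (rule m)
  show "submonoid (carrier (dual_braid_monoid m)) (dual_braid_monoid n)"
  proof
    show "carrier (dual_braid_monoid m) \<subseteq> carrier (dual_braid_monoid n)"
      using sub unfolding c by (auto simp: carrier_dual_braid_monoid)
  next
    fix X Y assume "X \<in> carrier (dual_braid_monoid m)" "Y \<in> carrier (dual_braid_monoid m)"
    then show "X \<otimes>\<^bsub>dual_braid_monoid n\<^esub> Y \<in> carrier (dual_braid_monoid m)"
      using m monoid.m_closed[OF monoid_dual_braid_monoid[of m]] by metis
  next
    show "\<one>\<^bsub>dual_braid_monoid n\<^esub> \<in> carrier (dual_braid_monoid m)"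
      using o monoid.one_closed[OF monoid_dual_braid_monoid[of m]] by metis
  qed
qed

lemma phi_word_lists: "w \<in> lists (gens n) \<Longrightarrow> phi_word n w \<in> lists (gens n)"
  by (auto simp: in_lists_conv_set phi_word_def phi_letter_def gens_def split: if_splits)

lemma dual_rel_phi:
  assumes "dual_rel n u v"
  shows "dual_cong n (phi_word n u) (phi_word n v)"
proof -
  have R: "dual_cong n u v" if "dual_rel n u v" for u v
    using dual_cong.step[of "[]" n "[]" u v] that by simp
  from assms show ?thesis
  proof cases
    case (disjoint p q r s)
    then show ?thesis
      by (cases "q = n"; cases "s = n")
        (auto simp: phi_word_def phi_letter_def gens_def intro!: R intro: dual_rel.intros)
  next
    case (nested p q r s)
    then show ?thesis
      by (cases "q = n"; cases "s = n")
        (auto simp: phi_word_def phi_letter_def gens_def intro!: R intro: dual_rel.intros)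
  next
    case (triangle1 p q r)
    show ?thesis
    proof (cases "r = n")
      case True
      have "dual_cong n [(p + 1, q + 1), (1, q + 1)] [(1, q + 1), (1, p + 1)]"
        using triangle1 True by (intro R dual_rel.triangle2) auto
      then show ?thesis
        using triangle1 True by (simp add: phi_word_def phi_letter_def)
    next
      case False
      then show ?thesis
        using triangle1 dual_rel.triangle1[of "p + 1" "q + 1" "r + 1" n]
        by (auto simp: phi_word_def phi_letter_def intro!: R)
    qed
  next
    case (triangle2 p q r)
    show ?thesis
    proof (cases "r = n")
      case True
      have "dual_cong n [(1, p + 1), (p + 1, q + 1)] [(p + 1, q + 1), (1, q + 1)]"
        using triangle2 True by (intro R dual_rel.triangle1) auto
      moreover have "dual_cong n [(p + 1, q + 1), (1, q + 1)] [(1, q + 1), (1, p + 1)]"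
        using triangle2 True by (intro R dual_rel.triangle2) auto
      ultimately have "dual_cong n [(1, q + 1), (1, p + 1)] [(1, p + 1), (p + 1, q + 1)]"
        by (rule dual_cong.sym[OF dual_cong.trans])
      then show ?thesis
        using triangle2 True by (simp add: phi_word_def phi_letter_def)
    next
      case False
      then show ?thesis
        using triangle2 dual_rel.triangle2[of "p + 1" "q + 1" "r + 1" n]
        by (auto simp: phi_word_def phi_letter_def intro!: R)
    qed
  qed
qed

lemma dual_cong_phi:
  assumes "dual_cong n u v"
  shows "dual_cong n (phi_word n u) (phi_word n v)"
  using assms
proof induction
  case (step x y u v)
  then show ?case
    using dual_cong_ctxt[OF dual_rel_phi[OF step(3)] phi_word_lists phi_word_lists, of x y]
    by (simp add: phi_word_def)
next
  case (trans u v w)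
  then show ?case using dual_cong.trans by blast
next
  case (sym u v)
  then show ?case using dual_cong.sym by blast
qed (auto intro: dual_cong.refl phi_word_lists)

lemma phi_braid_of:
  assumes "w \<in> lists (gens n)"
  shows "phi_braid n (braid_of n w) = braid_of n (phi_word n w)"
proof -
  have "braid_of n (phi_word n v) = braid_of n (phi_word n w)" if "v \<in> braid_of n w" for v
    using that dual_cong_phi[of n w v] braid_of_eq_iff[OF phi_word_lists[OF assms], of "phi_word n v"]
    by (auto simp: braid_of_def)
  moreover have "w \<in> braid_of n w"
    using assms by (auto simp: braid_of_def intro: dual_cong.refl)
  ultimately show ?thesis
    unfolding phi_braid_def by blast
qed

lemma phi_braid_hom: "phi_braid n \<in> hom (dual_braid_monoid n) (dual_braid_monoid n)"
proof (rule homI)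
  fix X assume "X \<in> carrier (dual_braid_monoid n)"
  then show "phi_braid n X \<in> carrier (dual_braid_monoid n)"
    using phi_word_lists
    by (auto simp: carrier_dual_braid_monoid phi_braid_of)
next
  fix X Y assume "X \<in> carrier (dual_braid_monoid n)" "Y \<in> carrier (dual_braid_monoid n)"
  then obtain x y where "X = braid_of n x" "Y = braid_of n y"
    and l: "x \<in> lists (gens n)" "y \<in> lists (gens n)"
    unfolding carrier_dual_braid_monoid by blast
  moreover have "x @ y \<in> lists (gens n)" using l by auto
  moreover have "phi_word n (x @ y) = phi_word n x @ phi_word n y" by (simp add: phi_word_def)
  ultimately show "phi_braid n (X \<otimes>\<^bsub>dual_braid_monoid n\<^esub> Y) =
      phi_braid n X \<otimes>\<^bsub>dual_braid_monoid n\<^esub> phi_braid n Y"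
    using phi_word_lists by (simp add: mult_braid_of phi_braid_of)
qed

declare in_listsD [dest!] in_listsI [intro!]

end

theory Submission
  imports Defs
begin

text \<open>The monoid of dual braids on n strands has left lcms, and this is what makes tails and the
rotating normal form well behaved. Write \<open>lcompl x y\<close> for the word to be put to the left of the
letter \<open>y\<close> in order to obtain the left lcm of the letters \<open>x\<close> and \<open>y\<close>. The central algebraic fact,
\<open>left_lcm_universal\<close>, says that if \<open>u x\<close> and \<open>v y\<close> represent the same braid, then both are left
multiples of this lcm; as usual for complemented presentations it follows, by induction on the
length, from a cube condition on triples of letters. A triple of letters involves at most six strand
indices and everything is compatible with increasing relabellings, so the cube condition is a
finite computation on six strands.

Consequently a braid with trivial tail behaves like a normal form relative to the smaller monoid:
the decomposition of a braid as a trivial-tail braid times a braid on n - 1 strands is unique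
(\<open>tail_unique\<close>), splittings exist and are unique, and the rotating words are the words
\<open>phi_concat n ws\<close> where the entries are rotating and all the partial products
\<open>phi_word n (phi_concat n (take k ws))\<close> have trivial tail (\<open>rotating_iff_splitting_words\<close>).

It remains to decide when \<open>phi_word n (P @ v)\<close> has a trivial tail, for \<open>P\<close> with trivial tail and \<open>v\<close>
rotating on n - 1 strands. A nonempty \<open>P\<close> has a unique last letter \<open>(p, n)\<close>, and the only obstruction
not already visible on the last letter of \<open>v\<close> is a right divisor \<open>(i, n)\<close> of \<open>P @ v\<close> with
\<open>i \<le> n - 2\<close>. Two opposite movements control it.
 \<^item> If all letters \<open>(r, s)\<close> of \<open>v\<close> satisfy \<open>p \<le> r\<close>, then \<open>(p, n)\<close> can be pushed to the right through
   \<open>v\<close> (\<open>push_right\<close>), so the obstruction occurs when \<open>p \<noteq> n - 1\<close>.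
 \<^item> A right divisor \<open>(i, n)\<close> of \<open>P @ v\<close> can be traced to the left through \<open>v\<close>: it comes from a right
   divisor \<open>(trace v i, n)\<close> of \<open>P\<close> (\<open>trace_divides\<close>), whence \<open>trace v i = p\<close>. As the trace is monotone,
   there is no obstruction when \<open>trace v (n - 2) < p\<close>.

For rotating words that end in a letter \<open>(q, n - 1)\<close> these are the only two cases, and it is the
presence of a barrier that separates them. This is the \<open>barrier_dichotomy\<close>; it is proved by
induction on the number of strands together with the characterisation, since the entries of the
splitting of a rotating word on n strands are rotating words on n - 1 strands.\<close>

section \<open>Left lcms of letters\<close>

text \<open>Place the points 1, ..., n on a circle, so that \<open>(r, s)\<close> is a chord. When this chord is put to the
right of a braid, points strictly between \<open>r\<close> and \<open>s\<close> get attached to it through \<open>s\<close>, and the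
remaining points through \<open>r\<close>; \<open>link (r, s) k\<close> is the corresponding chord from \<open>k\<close>.\<close>

definition link :: "letter \<Rightarrow> nat \<Rightarrow> letter" where
  "link = (\<lambda>(r, s) k. if r < k \<and> k < s then (k, s) else if k < r then (k, r) else (r, k))"

text \<open>The left lcm of \<open>x\<close> and \<open>y\<close> is represented by \<open>lcompl x y @ [y]\<close>. Two chords with a common end
span a triangle, whose lcm has length two; disjoint or nested chords commute; crossing chords
span a quadrilateral, whose lcm has length three. In the last case the two letters of the
complement commute, and the one that links an outer point is put last, which is the order needed
in \<open>trace_divides\<close>.\<close>

definition lcompl :: "letter \<Rightarrow> letter \<Rightarrow> word" where
  "lcompl = (\<lambda>(i, j) (r, s).
    if (i, j) = (r, s) then []
    else if i = r \<or> i = s then [link (r, s) j]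
    else if j = r \<or> j = s then [link (r, s) i]
    else if (r < i \<and> i < s) = (r < j \<and> j < s) then [(i, j)]
    else if r < i \<and> i < s then [link (r, s) i, link (r, s) j]
    else [link (r, s) j, link (r, s) i])"

lemma dual_cong_length:
  assumes "dual_cong n u v"
  shows "length u = length v"
  using assms by induction (auto elim: dual_rel.cases)

lemma dual_cong_appendL:
  assumes "dual_cong n u v" "x \<in> lists (gens n)"
  shows "dual_cong n (x @ u) (x @ v)"
  using dual_cong_append[OF dual_cong.refl[OF assms(2)] assms(1)] .

lemma dual_cong_appendR:
  assumes "dual_cong n u v" "x \<in> lists (gens n)"
  shows "dual_cong n (u @ x) (v @ x)"
  using dual_cong_append[OF assms(1) dual_cong.refl[OF assms(2)]] .

lemmas dual_rel_dual_cong = dual_cong.step[of "[]" _ "[]", simplified]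

lemma lcompl_gens:
  assumes "x \<in> gens n" "y \<in> gens n"
  shows "lcompl x y \<in> lists (gens n)"
  using assms by (cases x; cases y) (auto simp: lcompl_def link_def gens_def)

lemma lcompl_same [simp]: "lcompl x x = []"
  by (cases x) (simp add: lcompl_def)

text \<open>The lcm of two crossing chords: both words represent the product of the quadrilateral with vertices
\<open>p\<close>, \<open>r\<close>, \<open>q\<close>, \<open>s\<close>, and three triangle relations connect them.\<close>

lemma crossing_lcm:
  assumes "1 \<le> p" "p < r" "r < q" "q < s" "s \<le> n"
  shows "dual_cong n [(q, s), (p, r), (r, s)] [(r, q), (p, s), (p, q)]"
proof -
  have 1: "dual_cong n [(p, r), (r, s)] [(r, s), (p, s)]"
    and 2: "dual_cong n [(r, q), (q, s)] [(q, s), (r, s)]"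
    and 3: "dual_cong n [(q, s), (p, s)] [(p, s), (p, q)]"
    using assms by (auto intro!: dual_rel_dual_cong dual_rel.triangle1 dual_rel.triangle2)
  have "dual_cong n [(q, s), (p, r), (r, s)] [(q, s), (r, s), (p, s)]"
    using dual_cong_appendL[OF 1, of "[(q, s)]"] assms by (auto simp: gens_def)
  moreover have "dual_cong n [(r, q), (q, s), (p, s)] [(q, s), (r, s), (p, s)]"
    using dual_cong_appendR[OF 2, of "[(p, s)]"] assms by (auto simp: gens_def)
  moreover have "dual_cong n [(r, q), (q, s), (p, s)] [(r, q), (p, s), (p, q)]"
    using dual_cong_appendL[OF 3, of "[(r, q)]"] assms by (auto simp: gens_def)
  ultimately show ?thesis
    by (meson dual_cong.sym dual_cong.trans)
qed

text \<open>The presentation is complemented: every defining relation equates the two expressions of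
the left lcm of the two final letters.\<close>

lemma dual_rel_lcompl:
  assumes "dual_rel n u v"
  shows "\<exists>x y. u = lcompl x y @ [y] \<and> v = lcompl y x @ [x]"
  using assms
proof cases
  case (disjoint p q r s)
  then show ?thesis
    by (intro exI[of _ "(p, q)"] exI[of _ "(r, s)"]) (auto simp: lcompl_def link_def gens_def)
next
  case (nested p q r s)
  then show ?thesis
    by (intro exI[of _ "(p, q)"] exI[of _ "(r, s)"]) (auto simp: lcompl_def link_def gens_def)
next
  case (triangle1 p q r)
  then show ?thesis
    by (intro exI[of _ "(p, r)"] exI[of _ "(q, r)"]) (auto simp: lcompl_def link_def gens_def)
next
  case (triangle2 p q r)
  then show ?thesis
    by (intro exI[of _ "(p, q)"] exI[of _ "(p, r)"]) (auto simp: lcompl_def link_def gens_def)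
qed

lemma lcompl_cong:
  assumes "x \<in> gens n" "y \<in> gens n"
  shows "dual_cong n (lcompl x y @ [y]) (lcompl y x @ [x])"
proof -
  obtain p q r s where xy: "x = (p, q)" "y = (r, s)" by fastforce
  have pq: "1 \<le> p" "p < q" "q \<le> n" "1 \<le> r" "r < s" "s \<le> n"
    using assms xy by (auto simp: gens_def)
  have triangles: "dual_cong n [(i, j), (j, k)] [(j, k), (i, k)]"
     "dual_cong n [(j, k), (i, k)] [(i, k), (i, j)]"
     "dual_cong n [(i, j), (j, k)] [(i, k), (i, j)]" if "1 \<le> i" "i < j" "j < k" "k \<le> n" for i j k
    using dual_rel_dual_cong[OF dual_rel.triangle1[OF that]] dual_rel_dual_cong[OF dual_rel.triangle2[OF that]]
    by (auto intro: dual_cong.trans)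
  note tri = triangles triangles[THEN dual_cong.sym]
  consider "x = y" | "p = r" "q \<noteq> s" | "p = s" | "q = r" | "q = s" "p \<noteq> r"
    | "p < r" "r < q" "q < s" | "r < p" "p < s" "s < q"
    | "q < r \<or> s < p \<or> (r < p \<and> q < s) \<or> (p < r \<and> s < q)"
    using pq xy by (cases "p = r"; cases "q = s"; cases "p = s"; cases "q = r") force+
  then show ?thesis
  proof cases
    case 1
    then show ?thesis using assms by (auto intro: dual_cong.refl)
  next
    case 2
    then show ?thesis using pq xy by (cases q s rule: linorder_cases) (auto simp: lcompl_def link_def intro: tri)
  next
    case 3
    then show ?thesis using pq xy by (auto simp: lcompl_def link_def intro: tri)
  next
    case 4
    then show ?thesis using pq xy by (auto simp: lcompl_def link_def intro: tri)
  next
    case 5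
    then show ?thesis using pq xy by (cases p r rule: linorder_cases) (auto simp: lcompl_def link_def intro: tri)
  next
    case 6
    then show ?thesis using pq xy crossing_lcm[of p r q s n] by (auto simp: lcompl_def link_def)
  next
    case 7
    then show ?thesis
      using pq xy crossing_lcm[of r p s q n] by (auto simp: lcompl_def link_def intro: dual_cong.sym)
  next
    case 8
    have "lcompl x y = [x]" "lcompl y x = [y]"
      using 8 pq xy by (auto simp: lcompl_def link_def)
    moreover have "dual_rel n [x, y] [y, x]"
      using 8 assms xy by (auto intro: dual_rel.intros)
    ultimately show ?thesis
      by (simp add: dual_rel_dual_cong)
  qed
qed

section \<open>Left lcms of words and the cube condition\<close>

text \<open>Computes complements \<open>c\<close>, \<open>d\<close> such that \<open>c @ a\<close> and \<open>d @ b\<close> both represent the left lcm of the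
words \<open>a\<close> and \<open>b\<close>, by iterating the complement of letters from right to left. The iteration is not
structurally recursive, so the first argument bounds the depth of the recursion.\<close>

fun lcm_words :: "nat \<Rightarrow> word \<Rightarrow> word \<Rightarrow> (word \<times> word) option" where
  "lcm_words 0 a b = None"
| "lcm_words (Suc k) a b =
    (if a = [] then Some (b, []) else if b = [] then Some ([], a)
     else case lcm_words k (butlast a) (lcompl (last b) (last a)) of None \<Rightarrow> None
     | Some (c1, d1) \<Rightarrow>
       (case lcm_words k (butlast b) (lcompl (last a) (last b)) of None \<Rightarrow> None
       | Some (c2, d2) \<Rightarrow> map_option (\<lambda>(e1, e2). (e1 @ c1, e2 @ c2)) (lcm_words k d1 d2)))"

text \<open>The lcm of \<open>x\<close>, \<open>y\<close>, \<open>z\<close> obtained by first combining both \<open>x\<close> and \<open>z\<close> with \<open>y\<close> is a common left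
multiple of the lcm of \<open>x\<close> and \<open>z\<close>, with the same quotient \<open>f\<close> on both sides. Running
\<open>lcm_words\<close> on two words with result \<open>([], [])\<close> certifies that they are congruent. A depth of nine
is enough for all the triples.\<close>

definition cube :: "letter \<Rightarrow> letter \<Rightarrow> letter \<Rightarrow> bool" where
  "cube x y z = (case lcm_words 9 (lcompl x y) (lcompl z y) of None \<Rightarrow> False
    | Some (c, d) \<Rightarrow>
      (case lcm_words 9 (c @ lcompl y x) (lcompl z x) of None \<Rightarrow> False
      | Some (e, f) \<Rightarrow> e = [] \<and> lcm_words 9 (d @ lcompl y z) (f @ lcompl x z) = Some ([], [])))"

definition relabel :: "(nat \<Rightarrow> nat) \<Rightarrow> letter \<Rightarrow> letter" where
  "relabel f = map_prod f f"

lemma lcompl_relabel: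
  assumes "strict_mono f"
  shows "lcompl (relabel f x) (relabel f y) = map (relabel f) (lcompl x y)"
  using assms
  by (cases x; cases y) (simp add: lcompl_def link_def relabel_def strict_mono_eq strict_mono_less)

lemma lcm_words_relabel:
  assumes f: "strict_mono f"
  shows "lcm_words k (map (relabel f) a) (map (relabel f) b) =
    map_option (map_prod (map (relabel f)) (map (relabel f))) (lcm_words k a b)"
proof (induction k arbitrary: a b)
  case (Suc k)
  show ?case
  proof (cases "a = [] \<or> b = []")
    case False
    then obtain a' x b' y where "a = a' @ [x]" "b = b' @ [y]"
      by (metis rev_exhaust)
    then show ?thesis
      by (simp add: Suc lcompl_relabel[OF f] option.case_eq_if option.map_sel prod.case_eq_if
          option.map_comp comp_def)
  qed auto
qed simp

lemma cube_relabel: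
  assumes f: "strict_mono f"
  shows "cube (relabel f x) (relabel f y) (relabel f z) = cube x y z"
  by (simp add: cube_def lcompl_relabel[OF f] lcm_words_relabel[OF f] map_append[symmetric]
      option.case_eq_if option.map_sel prod.case_eq_if del: map_append)

text \<open>The finitely many indices occurring in a few letters can be compressed to an initial segment, so
that questions about three letters need only be settled on six strands.\<close>

lemma ex_relabelling:
  assumes "finite S" "\<And>s. s \<in> S \<Longrightarrow> 1 \<le> s"
  shows "\<exists>f. strict_mono f \<and> f ` {1..card S} = S \<and> f 0 = (0::nat)"
  using assms
proof (induction S rule: finite_linorder_max_induct)
  case empty
  show ?case by (intro exI[of _ id]) (auto simp: strict_mono_def)
next
  case (insert b A)
  then obtain f where f: "strict_mono f" "f ` {1..card A} = A" "f 0 = 0" by auto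
  define g where "g k = (if k \<le> card A then f k else b + (k - card A - 1))" for k
  have b: "f (card A) < b"
  proof (cases "card A = 0")
    case True
    then show ?thesis using f(3) insert.prems by fastforce
  next
    case False
    then have "f (card A) \<in> A" using f(2) by (metis atLeastAtMost_iff imageI le_refl less_one not_less)
    then show ?thesis using insert.hyps by auto
  qed
  have "g k < g (Suc k)" for k
    using b f(1) by (cases "k < card A"; cases "k = card A") (auto simp: g_def strict_mono_less)
  then have "strict_mono g" by (simp add: strict_mono_Suc_iff)
  moreover have "g ` {1..card (insert b A)} = insert b A"
  proof -
    have "b \<notin> A" using insert.hyps by auto
    then have "{1..card (insert b A)} = insert (Suc (card A)) {1..card A}"
      using insert.hyps by auto
    moreover have "g ` {1..card A} = f ` {1..card A}"
      by (intro image_cong) (auto simp: g_def)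
    moreover have "g (Suc (card A)) = b"
      by (simp add: g_def)
    ultimately show ?thesis
      using f(2) by (simp only: image_insert)
  qed
  moreover have "g 0 = 0" using f(3) by (simp add: g_def)
  ultimately show ?case by blast
qed

definition atoms :: "nat \<Rightarrow> letter list" where
  "atoms n = concat (map (\<lambda>q. map (\<lambda>p. (p, q)) [1..<q]) [1..<Suc n])"

lemma set_atoms: "set (atoms n) = gens n"
  unfolding atoms_def gens_def set_concat set_map set_upt by (fastforce simp: image_iff)

definition no_gap :: "nat list \<Rightarrow> bool" where
  "no_gap ks = list_all (\<lambda>k. k \<le> 1 \<or> k - 1 \<in> set ks) ks"

text \<open>A triple with a gap among its indices is a relabelling of one without gaps, and leaving out
these triples makes the computation about eight times shorter.\<close>

lemma cube_six_strands: "list_all (\<lambda>x. list_all (\<lambda>y. list_all (\<lambda>z.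
    if no_gap [fst x, snd x, fst y, snd y, fst z, snd z] then cube x y z else True)
    (atoms 6)) (atoms 6)) (atoms 6)"
  by code_simp

lemma cube_gens:
  assumes "x \<in> gens n" "y \<in> gens n" "z \<in> gens n"
  shows "cube x y z"
proof -
  define ks where "ks = [fst x, snd x, fst y, snd y, fst z, snd z]"
  have "1 \<le> k" if "k \<in> set ks" for k
    using that assms by (auto simp: ks_def gens_def)
  then obtain f where f: "strict_mono f" "f ` {1..card (set ks)} = set ks"
    using ex_relabelling[of "set ks"] by auto
  have card: "card (set ks) \<le> 6"
    using card_length[of ks] by (simp add: ks_def)
  define ks' where "ks' = map (inv_into {1..card (set ks)} f) ks"
  have ks': "ks = map f ks'" "set ks' \<subseteq> {1..card (set ks)}"
    using f(2) f_inv_into_f[of _ f "{1..card (set ks)}"] inv_into_into[of _ f "{1..card (set ks)}"]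
    by (auto simp: ks'_def intro!: map_idI[symmetric])
  have inj: "inj f" using f(1) by (rule strict_mono_imp_inj_on)
  have set': "set ks' = {1..card (set ks)}"
    using f(2) ks'(1) inj by (metis inj_image_eq_iff list.set_map)
  obtain a b c d e g where abc: "ks' = [a, b, c, d, e, g]"
    using ks'(1) by (auto simp: ks_def map_eq_Cons_conv)
  have xyz: "x = relabel f (a, b)" "y = relabel f (c, d)" "z = relabel f (e, g)"
    using ks'(1) abc by (auto simp: ks_def relabel_def prod_eq_iff)
  have "a < b" "c < d" "e < g"
    using assms xyz f(1) by (auto simp: gens_def relabel_def strict_mono_less)
  moreover have "{a, b, c, d, e, g} \<subseteq> {1..6}"
    using ks'(2) abc card by auto
  ultimately have "(a, b) \<in> set (atoms 6)" "(c, d) \<in> set (atoms 6)" "(e, g) \<in> set (atoms 6)"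
    unfolding set_atoms by (auto simp: gens_def)
  moreover have "no_gap ks'"
    unfolding no_gap_def list_all_iff set' by auto
  ultimately have "cube (a, b) (c, d) (e, g)"
    using cube_six_strands abc by (auto simp: list_all_iff)
  then show ?thesis
    unfolding xyz cube_relabel[OF f(1)] .
qed

lemma lcm_words_Some:
  assumes "lcm_words (Suc k) a b = Some (c, d)" "a \<noteq> []" "b \<noteq> []"
  obtains a' x b' y c1 d1 c2 d2 e1 e2 where "a = a' @ [x]" "b = b' @ [y]"
    "lcm_words k a' (lcompl y x) = Some (c1, d1)" "lcm_words k b' (lcompl x y) = Some (c2, d2)"
    "lcm_words k d1 d2 = Some (e1, e2)" "c = e1 @ c1" "d = e2 @ c2"
  using assms by (cases a rule: rev_cases; cases b rule: rev_cases) (auto split: option.splits)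

lemma lcm_words_sound:
  assumes "lcm_words k a b = Some (c, d)" "a \<in> lists (gens n)" "b \<in> lists (gens n)"
  shows "dual_cong n (c @ a) (d @ b)"
  using assms
proof (induction k arbitrary: a b c d)
  case (Suc k)
  show ?case
  proof (cases "a = [] \<or> b = []")
    case True
    then show ?thesis using Suc.prems by (auto intro: dual_cong.refl split: if_splits)
  next
    case False
    then obtain a' x b' y c1 d1 c2 d2 e1 e2 where *: "a = a' @ [x]" "b = b' @ [y]"
      "lcm_words k a' (lcompl y x) = Some (c1, d1)" "lcm_words k b' (lcompl x y) = Some (c2, d2)"
      "lcm_words k d1 d2 = Some (e1, e2)" "c = e1 @ c1" "d = e2 @ c2"
      using lcm_words_Some[OF Suc.prems(1)] by metis
    have l: "a' \<in> lists (gens n)" "x \<in> gens n" "b' \<in> lists (gens n)" "y \<in> gens n"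
      using Suc.prems * by auto
    note lcg = lcompl_gens[OF l(2,4)] lcompl_gens[OF l(4,2)]
    have 1: "dual_cong n (c1 @ a') (d1 @ lcompl y x)"
      using Suc.IH[OF *(3) l(1) lcg(2)] .
    have 2: "dual_cong n (c2 @ b') (d2 @ lcompl x y)"
      using Suc.IH[OF *(4) l(3) lcg(1)] .
    note l12 = dual_cong_lists[OF 1] dual_cong_lists[OF 2]
    have 3: "dual_cong n (e1 @ d1) (e2 @ d2)"
      using Suc.IH[OF *(5)] l12 by auto
    note l3 = dual_cong_lists[OF 3]
    have "dual_cong n (e1 @ (c1 @ a') @ [x]) (e1 @ (d1 @ lcompl y x) @ [x])"
      using l12 l3 l by (intro dual_cong_ctxt[OF 1]) auto
    also have "dual_cong n \<dots> ((e1 @ d1) @ (lcompl x y @ [y]))"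
      using dual_cong_appendL[OF lcompl_cong[OF l(4,2)], of "e1 @ d1"] l3 by auto
    also (dual_cong.trans) have "dual_cong n \<dots> ((e2 @ d2) @ (lcompl x y @ [y]))"
      using l lcg by (intro dual_cong_appendR[OF 3]) auto
    also (dual_cong.trans) have "dual_cong n \<dots> (e2 @ (c2 @ b') @ [y])"
      using dual_cong_ctxt[OF dual_cong.sym[OF 2], of e2 "[y]"] l12 l3 l by auto
    finally (dual_cong.trans) show ?thesis
      using * by simp
  qed
qed simp

section \<open>Universality of left lcms\<close>

text \<open>Universality of the left lcms of letters for words of bounded length, which is the induction
hypothesis in the proof of universality.\<close>

definition lcompl_below :: "nat \<Rightarrow> nat \<Rightarrow> bool" where
  "lcompl_below n l \<longleftrightarrow> (\<forall>u v x y. length u < l \<longrightarrow> dual_cong n (u @ [x]) (v @ [y]) \<longrightarrow>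
     (\<exists>w. dual_cong n u (w @ lcompl y x) \<and> dual_cong n v (w @ lcompl x y)))"

lemma lcompl_belowD:
  assumes "lcompl_below n l" "length u < l" "dual_cong n (u @ [x]) (v @ [y])"
  obtains w where "dual_cong n u (w @ lcompl y x)" "dual_cong n v (w @ lcompl x y)"
  using assms unfolding lcompl_below_def by blast

text \<open>Universality for letters carries over to words, as long as the common multiple is not longer than
the words for which universality for letters is known: each recursive call of \<open>lcm_words\<close>
corresponds to one application of universality to a shorter word.\<close>

lemma lcm_words_universal:
  assumes "lcompl_below n l" "lcm_words k a b = Some (c, d)" "dual_cong n (u @ a) (v @ b)"
    "length (u @ a) \<le> l"
  shows "\<exists>s. dual_cong n u (s @ c) \<and> dual_cong n v (s @ d)"
  using assms(2-)
proof (induction k arbitrary: a b c d u v)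
  case (Suc k)
  note len = dual_cong_length[OF Suc.prems(2)]
  note mem = dual_cong_lists[OF Suc.prems(2)]
  show ?case
  proof (cases "a = [] \<or> b = []")
    case True
    then show ?thesis
      using Suc.prems mem
      by (auto intro: dual_cong.refl dual_cong.sym split: if_splits)
  next
    case False
    then obtain a' x b' y c1 d1 c2 d2 e1 e2 where *: "a = a' @ [x]" "b = b' @ [y]"
      "lcm_words k a' (lcompl y x) = Some (c1, d1)" "lcm_words k b' (lcompl x y) = Some (c2, d2)"
      "lcm_words k d1 d2 = Some (e1, e2)" "c = e1 @ c1" "d = e2 @ c2"
      using lcm_words_Some[OF Suc.prems(1)] by metis
    have "dual_cong n ((u @ a') @ [x]) ((v @ b') @ [y])" "length (u @ a') < l"
      using Suc.prems * by auto
    then obtain w where w: "dual_cong n (u @ a') (w @ lcompl y x)" "dual_cong n (v @ b') (w @ lcompl x y)"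
      using lcompl_belowD[OF assms(1)] by metis
    obtain s1 where s1: "dual_cong n u (s1 @ c1)" "dual_cong n w (s1 @ d1)"
      using Suc.IH[OF *(3) w(1)] Suc.prems * by auto
    obtain s2 where s2: "dual_cong n v (s2 @ c2)" "dual_cong n w (s2 @ d2)"
      using Suc.IH[OF *(4) w(2)] Suc.prems * len by auto
    have "dual_cong n (s1 @ d1) (s2 @ d2)"
      using s1(2) s2(2) by (meson dual_cong.sym dual_cong.trans)
    moreover have "length (s1 @ d1) \<le> l"
      using dual_cong_length[OF s1(2)] dual_cong_length[OF w(1)] Suc.prems * by auto
    ultimately obtain s where s: "dual_cong n s1 (s @ e1)" "dual_cong n s2 (s @ e2)"
      using Suc.IH[OF *(5)] by auto
    have "dual_cong n u (s @ c)"
      using dual_cong.trans[OF s1(1) dual_cong_appendR[OF s(1)]] dual_cong_lists[OF s1(1)] * by auto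
    moreover have "dual_cong n v (s @ d)"
      using dual_cong.trans[OF s2(1) dual_cong_appendR[OF s(2)]] dual_cong_lists[OF s2(1)] * by auto
    ultimately show ?thesis by blast
  qed
qed simp

text \<open>By induction on a derivation of the congruence. The critical case is transitivity through a word ending in \<open>z\<close>:
the prefix before \<open>z\<close> is a left multiple of \<open>lcompl x z\<close> and of \<open>lcompl y z\<close>, hence, being
shorter, of their lcm, and the cube condition rearranges this into a multiple of the lcm of \<open>x\<close>
and \<open>y\<close>.\<close>

lemma lcompl_below_all: "lcompl_below n l"
proof (induction l)
  case 0
  show ?case by (simp add: lcompl_below_def)
next
  case (Suc l)
  have "\<exists>w. dual_cong n u (w @ lcompl y x) \<and> dual_cong n v (w @ lcompl x y)"
    if "dual_cong n (u @ [x]) (v @ [y])" "length u \<le> l" for u v x y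
  proof -
    have "\<exists>w. dual_cong n u (w @ lcompl y x) \<and> dual_cong n v (w @ lcompl x y)"
      if "dual_cong n X Y" "length u \<le> l" "X = u @ [x]" "Y = v @ [y]" for X Y u v x y
      using that
    proof (induction arbitrary: u v x y)
      case (step p q a b)
      note mem = dual_rel_lists[OF step(3)]
      show ?case
      proof (cases q rule: rev_cases)
        case Nil
        obtain x' y' where "a = lcompl x' y' @ [y']" "b = lcompl y' x' @ [x']"
          using dual_rel_lcompl[OF step(3)] by blast
        then have "u = p @ lcompl y x" "v = p @ lcompl x y"
          using step Nil by auto
        moreover have "dual_cong n u u" "dual_cong n v v"
          using step mem Nil calculation by (auto intro!: dual_cong.refl simp del: in_lists_conv_set)
        ultimately show ?thesis
          by (intro exI[of _ p]) simp
      next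
        case (snoc q' z)
        then have "u = p @ a @ q'" "v = p @ b @ q'" "x = z" "y = z"
          using step by auto
        moreover have "dual_cong n (p @ a @ q') (p @ b @ q')"
          using step snoc by (intro dual_cong.step) auto
        moreover have "dual_cong n v v"
          using calculation dual_cong_lists dual_cong.refl by blast
        ultimately show ?thesis
          by (intro exI[of _ v]) simp
      qed
    next
      case (refl w)
      then show ?case by (intro exI[of _ u]) (auto intro: dual_cong.refl)
    next
      case (sym X Y)
      then have "length v \<le> l"
        using dual_cong_length[OF sym(1)] by simp
      then show ?case
        using sym.IH[of v y u x] sym.prems by blast
    next
      case (trans X Y Z)
      have len: "length X = length Y" "length Y = length Z"
        using trans dual_cong_length by blast+
      then obtain t z where Y: "Y = t @ [z]"
        using trans.prems by (cases Y rule: rev_cases) auto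
      obtain w where w: "dual_cong n u (w @ lcompl z x)" "dual_cong n t (w @ lcompl x z)"
        using trans.IH(1)[OF _ trans.prems(2) Y] trans.prems by blast
      obtain w' where w': "dual_cong n t (w' @ lcompl y z)" "dual_cong n v (w' @ lcompl z y)"
        using trans.IH(2)[OF _ Y trans.prems(3)] trans.prems len Y by auto
      have g: "x \<in> gens n" "y \<in> gens n" "z \<in> gens n"
        using dual_cong_lists[OF trans(1)] dual_cong_lists[OF trans(2)] trans.prems Y by auto
      obtain c d f where cube: "lcm_words 9 (lcompl x z) (lcompl y z) = Some (c, d)"
        "lcm_words 9 (c @ lcompl z x) (lcompl y x) = Some ([], f)"
        "lcm_words 9 (d @ lcompl z y) (f @ lcompl x y) = Some ([], [])"
        using cube_gens[OF g(1,3,2)] by (auto simp: cube_def split: option.splits)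
      have tt: "dual_cong n (w @ lcompl x z) (w' @ lcompl y z)"
        using w w' by (meson dual_cong.sym dual_cong.trans)
      obtain s where s: "dual_cong n w (s @ c)" "dual_cong n w' (s @ d)"
        using lcm_words_universal[OF Suc.IH cube(1) tt] dual_cong_length[OF w(2)] len Y trans.prems by auto
      note m = dual_cong_lists[OF s(1)] dual_cong_lists[OF s(2)]
      note lcg = lcompl_gens[OF g(1,2)] lcompl_gens[OF g(2,1)] lcompl_gens[OF g(1,3)] lcompl_gens[OF g(3,1)]
        lcompl_gens[OF g(2,3)] lcompl_gens[OF g(3,2)]
      have 1: "dual_cong n (c @ lcompl z x) (f @ lcompl y x)"
        using lcm_words_sound[OF cube(2)] m lcg by auto
      have 2: "dual_cong n (d @ lcompl z y) (f @ lcompl x y)"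
        using lcm_words_sound[OF cube(3)] m lcg dual_cong_lists[OF 1] by auto
      have "dual_cong n u (s @ c @ lcompl z x)"
        using dual_cong.trans[OF w(1) dual_cong_appendR[OF s(1) lcg(4)]] by simp
      then have u: "dual_cong n u (s @ f @ lcompl y x)"
        by (rule dual_cong.trans) (use dual_cong_appendL[OF 1, of s] m in auto)
      have "dual_cong n v (s @ d @ lcompl z y)"
        using dual_cong.trans[OF w'(2) dual_cong_appendR[OF s(2) lcg(6)]] by simp
      then have "dual_cong n v (s @ f @ lcompl x y)"
        by (rule dual_cong.trans) (use dual_cong_appendL[OF 2, of s] m in auto)
      with u show ?case by (intro exI[of _ "s @ f"]) simp
    qed
    then show ?thesis using that by blast
  qed
  then show ?case by (auto simp: lcompl_below_def)
qed

lemma left_lcm_universal: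
  assumes "dual_cong n (u @ [x]) (v @ [y])"
  obtains w where "dual_cong n u (w @ lcompl y x)" "dual_cong n v (w @ lcompl x y)"
  using lcompl_belowD[OF lcompl_below_all[of n "Suc (length u)"]] assms by blast

text \<open>Any common left multiple of two words on m letters is a multiple of a common multiple formed within
the monoid on m strands: the complements never leave it. This is how divisibility in the large
monoid is transferred to the small one.\<close>

lemma common_multiple:
  assumes "dual_cong n (u @ a) (v @ b)" "a \<in> lists (gens m)" "b \<in> lists (gens m)"
  obtains s c d where "dual_cong n u (s @ c)" "dual_cong n v (s @ d)" "dual_cong m (c @ a) (d @ b)"
proof -
  have "\<exists>s c d. dual_cong n u (s @ c) \<and> dual_cong n v (s @ d) \<and> dual_cong m (c @ a) (d @ b)"
    using assms
  proof (induction "length (u @ a)" arbitrary: u a v b rule: less_induct)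
    case less
    note len = dual_cong_length[OF less.prems(1)]
    note mem = dual_cong_lists[OF less.prems(1)]
    show ?case
    proof (cases "a = [] \<or> b = []")
      case True
      then show ?thesis
      proof
        assume "a = []"
        then show ?thesis using less.prems mem
          by (intro exI[of _ v] exI[of _ b] exI[of _ "[]"]) (auto intro: dual_cong.refl)
      next
        assume "b = []"
        then show ?thesis using less.prems mem
          by (intro exI[of _ u] exI[of _ "[]"] exI[of _ a]) (auto intro: dual_cong.refl dual_cong.sym)
      qed
    next
      case False
      then obtain a' x b' y where *: "a = a' @ [x]" "b = b' @ [y]"
        by (metis rev_exhaust)
      have l: "a' \<in> lists (gens m)" "x \<in> gens m" "b' \<in> lists (gens m)" "y \<in> gens m"
        using less.prems * by auto
      note lcg = lcompl_gens[OF l(2,4)] lcompl_gens[OF l(4,2)]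
      obtain w where w: "dual_cong n (u @ a') (w @ lcompl y x)" "dual_cong n (v @ b') (w @ lcompl x y)"
        using left_lcm_universal[of n "u @ a'" x "v @ b'" y] less.prems * by auto
      obtain s1 c1 d1 where s1: "dual_cong n u (s1 @ c1)" "dual_cong n w (s1 @ d1)"
        "dual_cong m (c1 @ a') (d1 @ lcompl y x)"
        using less.hyps[OF _ w(1) l(1) lcg(2)] * by auto
      obtain s2 c2 d2 where s2: "dual_cong n v (s2 @ c2)" "dual_cong n w (s2 @ d2)"
        "dual_cong m (c2 @ b') (d2 @ lcompl x y)"
        using less.hyps[OF _ w(2) l(3) lcg(1)] * len by auto
      have "dual_cong n (s1 @ d1) (s2 @ d2)"
        using s1(2) s2(2) by (meson dual_cong.sym dual_cong.trans)
      moreover have "length (s1 @ d1) < length (u @ a)"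
        using dual_cong_length[OF s1(2)] dual_cong_length[OF w(1)] * by auto
      moreover have "d1 \<in> lists (gens m)" "d2 \<in> lists (gens m)"
        using dual_cong_lists[OF s1(3)] dual_cong_lists[OF s2(3)] by auto
      ultimately obtain s e1 e2 where s: "dual_cong n s1 (s @ e1)" "dual_cong n s2 (s @ e2)"
        "dual_cong m (e1 @ d1) (e2 @ d2)"
        using less.hyps by blast
      note l3 = dual_cong_lists[OF s1(3)] dual_cong_lists[OF s2(3)] dual_cong_lists[OF s(3)]
      have "dual_cong m (e1 @ (c1 @ a') @ [x]) (e1 @ (d1 @ lcompl y x) @ [x])"
        using l3 l by (intro dual_cong_ctxt[OF s1(3)]) auto
      also have "dual_cong m \<dots> ((e1 @ d1) @ (lcompl x y @ [y]))"
        using dual_cong_appendL[OF lcompl_cong[OF l(4,2)], of "e1 @ d1"] l3 by auto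
      also (dual_cong.trans) have "dual_cong m \<dots> ((e2 @ d2) @ (lcompl x y @ [y]))"
        using l lcg by (intro dual_cong_appendR[OF s(3)]) auto
      also (dual_cong.trans) have "dual_cong m \<dots> (e2 @ (c2 @ b') @ [y])"
        using dual_cong_ctxt[OF dual_cong.sym[OF s2(3)], of e2 "[y]"] l3 l by auto
      finally (dual_cong.trans) have "dual_cong m ((e1 @ c1) @ a) ((e2 @ c2) @ b)"
        using * by simp
      moreover have "dual_cong n u (s @ e1 @ c1)"
        using dual_cong.trans[OF s1(1) dual_cong_appendR[OF s(1)]] dual_cong_lists[OF s1(1)] by auto
      moreover have "dual_cong n v (s @ e2 @ c2)"
        using dual_cong.trans[OF s2(1) dual_cong_appendR[OF s(2)]] dual_cong_lists[OF s2(1)] by auto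
      ultimately show ?thesis by blast
    qed
  qed
  then show ?thesis using that by blast
qed

section \<open>Braids with trivial tail\<close>

text \<open>A tail is trivial if and only if no single generator of the smaller monoid divides on the right;
see \<open>is_tail_one_iff\<close> for the agreement with the notion for braids.\<close>

definition trivial_tail :: "nat \<Rightarrow> word \<Rightarrow> bool" where
  "trivial_tail n w \<longleftrightarrow> w \<in> lists (gens n) \<and> (\<forall>u. \<forall>x\<in>gens (n - 1). \<not> dual_cong n w (u @ [x]))"

lemma trivial_tail_cong:
  assumes "trivial_tail n u" "dual_cong n u v"
  shows "trivial_tail n v"
proof -
  have "\<not> dual_cong n v (u' @ [x])" if "x \<in> gens (n - 1)" for u' x
    using assms(1) that dual_cong.trans[OF assms(2), of "u' @ [x]"]
    unfolding trivial_tail_def by blast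
  then show ?thesis
    using dual_cong_lists[OF assms(2)] unfolding trivial_tail_def by blast
qed

lemma trivial_tail_factor:
  assumes "trivial_tail n P" "dual_cong n P (s @ d)" "d \<in> lists (gens (n - 1))"
  shows "d = []"
proof (rule ccontr)
  assume "d \<noteq> []"
  then have "dual_cong n P ((s @ butlast d) @ [last d])" "last d \<in> gens (n - 1)"
    using assms last_in_set[of d] by auto
  then show False
    using assms(1) unfolding trivial_tail_def by blast
qed

lemma ex_tail:
  assumes "w \<in> lists (gens n)"
  shows "\<exists>P g. trivial_tail n P \<and> g \<in> lists (gens (n - 1)) \<and> dual_cong n w (P @ g)"
  using assms
proof (induction "length w" arbitrary: w rule: less_induct)
  case less
  show ?case
  proof (cases "trivial_tail n w")
    case True
    then show ?thesis
      using less.prems by (intro exI[of _ w] exI[of _ "[]"]) (auto intro: dual_cong.refl)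
  next
    case False
    then obtain u x where ux: "x \<in> gens (n - 1)" "dual_cong n w (u @ [x])"
      using less.prems unfolding trivial_tail_def by blast
    then obtain P g where Pg: "trivial_tail n P" "g \<in> lists (gens (n - 1))" "dual_cong n u (P @ g)"
      using less.hyps[of u] dual_cong_length[OF ux(2)] dual_cong_lists[OF ux(2)] by auto
    have "dual_cong n w ((P @ g) @ [x])"
      using dual_cong.trans[OF ux(2) dual_cong_appendR[OF Pg(3)]] dual_cong_lists[OF ux(2)] by auto
    then show ?thesis
      using Pg ux by (intro exI[of _ P] exI[of _ "g @ [x]"]) auto
  qed
qed

text \<open>Right-divisors from the smaller monoid of \<open>P @ g\<close> are right-divisors of \<open>g\<close>, because the part of
the common multiple lying beyond \<open>P\<close> must be trivial.\<close>

lemma tail_right_divisor: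
  assumes "trivial_tail n P" "dual_cong n (u @ z) (P @ g)"
    "z \<in> lists (gens (n - 1))" "g \<in> lists (gens (n - 1))"
  obtains h where "dual_cong n u (P @ h)" "dual_cong (n - 1) (h @ z) g"
proof -
  obtain s c d where *: "dual_cong n u (s @ c)" "dual_cong n P (s @ d)" "dual_cong (n - 1) (c @ z) (d @ g)"
    using common_multiple[OF assms(2-4)] .
  have d: "d = []"
    using trivial_tail_factor[OF assms(1) *(2)] dual_cong_lists[OF *(3)] by auto
  have "dual_cong n (s @ c) (P @ c)"
    using dual_cong_appendR[OF dual_cong.sym[OF *(2)], of c] d dual_cong_lists[OF *(1)] by auto
  then have "dual_cong n u (P @ c)"
    using *(1) dual_cong.trans by blast
  then show ?thesis
    using that *(3) d by simp
qed

lemma tail_unique: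
  assumes "trivial_tail n P" "trivial_tail n Q" "dual_cong n (P @ g) (Q @ h)"
    "g \<in> lists (gens (n - 1))" "h \<in> lists (gens (n - 1))"
  shows "dual_cong n P Q" "dual_cong (n - 1) g h"
proof -
  obtain s c d where *: "dual_cong n P (s @ c)" "dual_cong n Q (s @ d)" "dual_cong (n - 1) (c @ g) (d @ h)"
    using common_multiple[OF assms(3-5)] .
  have cd: "c = []" "d = []"
    using trivial_tail_factor[OF assms(1) *(1)] trivial_tail_factor[OF assms(2) *(2)]
      dual_cong_lists[OF *(3)] by auto
  show "dual_cong n P Q"
    using dual_cong.trans[OF *(1)] dual_cong.sym[OF *(2)] cd by simp
  show "dual_cong (n - 1) g h"
    using *(3) cd by simp
qed

text \<open>Two distinct final letters \<open>(i, n)\<close> and \<open>(j, n)\<close> with \<open>i < j\<close> would force their lcm, hence also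
the third side \<open>(i, j)\<close> of the triangle, to divide on the right.\<close>

lemma trivial_tail_last_unique:
  assumes "trivial_tail n P" "dual_cong n P (u @ [(i, n)])" "dual_cong n P (v @ [(j, n)])"
  shows "i = j"
proof -
  have False if P: "dual_cong n P (u @ [(i, n)])" "dual_cong n P (v @ [(j, n)])" and "i < j" for u v i j
  proof -
    have "dual_cong n (u @ [(i, n)]) (v @ [(j, n)])"
      by (rule dual_cong.trans[OF dual_cong.sym[OF P(1)] P(2)])
    then obtain w where w: "dual_cong n u (w @ lcompl (j, n) (i, n))"
      using left_lcm_universal by blast
    have ij: "1 \<le> i" "j < n"
      using dual_cong_lists[OF P(1)] dual_cong_lists[OF P(2)] by (auto simp: gens_def)
    have "dual_cong n (u @ [(i, n)]) (w @ [(j, n), (i, n)])"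
      using dual_cong_appendR[OF w, of "[(i, n)]"] ij \<open>i < j\<close> by (auto simp: lcompl_def link_def gens_def)
    then have "dual_cong n P (w @ [(j, n), (i, n)])"
      by (rule dual_cong.trans[OF P(1)])
    moreover have "dual_cong n (w @ [(j, n), (i, n)]) (w @ [(i, n), (i, j)])"
      using dual_cong_lists[OF w] ij \<open>i < j\<close>
      by (intro dual_cong_appendL dual_rel_dual_cong dual_rel.triangle2) auto
    ultimately have "dual_cong n P (w @ [(i, n), (i, j)])"
      by (rule dual_cong.trans)
    then have "dual_cong n P ((w @ [(i, n)]) @ [(i, j)])"
      by simp
    moreover have "(i, j) \<in> gens (n - 1)"
      using ij \<open>i < j\<close> by (auto simp: gens_def)
    ultimately show False
      using assms(1) unfolding trivial_tail_def by blast
  qed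
  then show ?thesis
    using assms(2,3) by (metis linorder_neqE_nat)
qed

lemma trivial_tail_last:
  assumes "trivial_tail n P" "P \<noteq> []"
  shows "last P = (fst (last P), n)" "last P \<in> gens n"
proof -
  have P: "P \<in> lists (gens n)"
    using assms unfolding trivial_tail_def by blast
  have "dual_cong n P (butlast P @ [last P])"
    using dual_cong.refl[OF P] append_butlast_last_id[OF assms(2)] by simp
  then have "last P \<notin> gens (n - 1)"
    using assms unfolding trivial_tail_def by blast
  moreover show "last P \<in> gens n"
    using P last_in_set[OF assms(2)] by blast
  ultimately show "last P = (fst (last P), n)"
    by (cases "last P") (auto simp: gens_def)
qed

section \<open>Moving letters through words on fewer strands\<close>

text \<open>The letter \<open>(p, n)\<close> survives at the right end: it commutes with letters nested inside it, and with
\<open>(p, s)\<close> it spans a triangle whose lcm is also divisible by \<open>(p, n)\<close>.\<close>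

lemma push_right:
  assumes "v \<in> lists (gens (n - 1))" "\<And>r s. (r, s) \<in> set v \<Longrightarrow> p \<le> r" "(p, n) \<in> gens n" "u \<in> lists (gens n)"
  shows "\<exists>u'. dual_cong n (u @ [(p, n)] @ v) (u' @ [(p, n)])"
  using assms
proof (induction v arbitrary: u rule: list.induct)
  case Nil
  then show ?case by (intro exI[of _ u]) (auto intro!: dual_cong.refl)
next
  case (Cons y v)
  obtain r s where y: "y = (r, s)" by (cases y)
  have "(r, s) \<in> gens (n - 1)" "p \<le> r"
    using Cons.prems(1) Cons.prems(2)[of r s] y by simp_all
  then have rs: "1 \<le> r" "r < s" "s \<le> n - 1" "p \<le> r" "1 \<le> p" "p < n"
    using Cons.prems(3) by (auto simp: gens_def)
  have "\<exists>z\<in>gens n. dual_cong n [(p, n), y] [z, (p, n)]"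
  proof (cases "p = r")
    case True
    have "dual_cong n [(s, n), (r, n)] [(r, n), (r, s)]"
      using rs by (intro dual_rel_dual_cong dual_rel.triangle2) auto
    then show ?thesis
      using True y rs by (intro bexI[of _ "(s, n)"]) (auto simp: gens_def intro: dual_cong.sym)
  next
    case False
    then show ?thesis
      using y rs by (intro bexI[of _ y] dual_rel_dual_cong) (auto simp: gens_def intro!: dual_rel.nested)
  qed
  then obtain z where z: "z \<in> gens n" "dual_cong n [(p, n), y] [z, (p, n)]" by blast
  have v: "v \<in> lists (gens n)"
    using Cons.prems gens_mono[of "n - 1" n] by auto
  have 1: "dual_cong n (u @ [(p, n), y] @ v) (u @ [z, (p, n)] @ v)"
    using dual_cong_ctxt[OF z(2) Cons.prems(4) v] .
  obtain u' where "dual_cong n ((u @ [z]) @ [(p, n)] @ v) (u' @ [(p, n)])"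
    using Cons.IH[of "u @ [z]"] Cons.prems z by auto
  then have "dual_cong n (u @ [(p, n)] @ y # v) (u' @ [(p, n)])"
    using dual_cong.trans[OF 1] by simp
  then show ?case by blast
qed

text \<open>The index \<open>i\<close> of a right divisor \<open>(i, n)\<close>, followed from right to left through \<open>v\<close>.\<close>

definition trace :: "word \<Rightarrow> nat \<Rightarrow> nat" where
  "trace v i = foldr (\<lambda>(r, s) i. if r < i \<and> i \<le> s then r else i) v i"

lemma trace_simps [simp]:
  "trace [] i = i"
  "trace (u @ v) i = trace u (trace v i)"
  "trace ((r, s) # u) i = (if r < trace u i \<and> trace u i \<le> s then r else trace u i)"
  by (simp_all add: trace_def)

lemma trace_le: "trace v i \<le> i"
  by (induction v) (auto simp: Let_def)

lemma trace_mono: "i \<le> j \<Longrightarrow> trace v i \<le> trace v j"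
  by (induction v) (auto simp: Let_def)

text \<open>One step is the computation of \<open>lcompl (i, n) (r, s)\<close>, which always ends in the letter
\<open>(trace [(r, s)] i, n)\<close>.\<close>

lemma trace_divides:
  assumes "dual_cong n (u @ [(i, n)]) (P @ v)" "v \<in> lists (gens (n - 1))"
  shows "\<exists>u'. dual_cong n P (u' @ [(trace v i, n)])"
  using assms
proof (induction v arbitrary: u i rule: rev_induct)
  case Nil
  then show ?case by (auto intro: dual_cong.sym)
next
  case (snoc y v)
  obtain r s where y: "y = (r, s)" by (cases y)
  have rs: "1 \<le> r" "r < s" "s < n"
    using snoc.prems y by (auto simp: gens_def)
  have i: "1 \<le> i" "i < n"
    using dual_cong_lists[OF snoc.prems(1)] by (auto simp: gens_def)
  have "dual_cong n (u @ [(i, n)]) ((P @ v) @ [(r, s)])"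
    using snoc.prems y by simp
  then obtain w where w: "dual_cong n (P @ v) (w @ lcompl (i, n) (r, s))"
    using left_lcm_universal by blast
  have "\<exists>l. lcompl (i, n) (r, s) = l @ [(trace [y] i, n)]"
    using rs i y by (auto simp: lcompl_def link_def)
  then obtain l where "lcompl (i, n) (r, s) = l @ [(trace [y] i, n)]" by blast
  then have "dual_cong n ((w @ l) @ [(trace [y] i, n)]) (P @ v)"
    using w dual_cong.sym by simp
  then show ?case
    using snoc.IH snoc.prems by fastforce
qed

section \<open>The rotation automorphism\<close>

lemma phi_word_append [simp]: "phi_word n (u @ v) = phi_word n u @ phi_word n v"
  by (simp add: phi_word_def)

lemma phi_word_Nil [simp]: "phi_word n [] = []" "phi_word n w = [] \<longleftrightarrow> w = []"
  by (simp_all add: phi_word_def)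

lemma phi_letter_add:
  assumes "1 \<le> p" "p < q" "q + k \<le> n"
  shows "(phi_letter n ^^ k) (p, q) = (p + k, q + k)"
  using assms by (induction k) (auto simp: phi_letter_def)

text \<open>On indices the rotation is \<open>p \<mapsto> p + 1\<close> modulo n. The letter wraps around exactly twice, once for each of
its ends, which splits the n steps into five pieces.\<close>

lemma phi_letter_period:
  assumes "x \<in> gens n"
  shows "(phi_letter n ^^ n) x = x"
proof -
  obtain p q where x: "x = (p, q)" by (cases x)
  have pq: "1 \<le> p" "p < q" "q \<le> n" using assms x by (auto simp: gens_def)
  have 1: "(phi_letter n ^^ (n - q)) (p, q) = (p + (n - q), n)"
    using phi_letter_add[of p q "n - q" n] pq by simp
  have 2: "(phi_letter n ^^ (q - p - 1)) (1, p + (n - q) + 1) = (q - p, n)"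
    using phi_letter_add[of 1 "p + (n - q) + 1" "q - p - 1" n] pq by simp
  have 3: "(phi_letter n ^^ (p - 1)) (1, q - p + 1) = (p, q)"
    using phi_letter_add[of 1 "q - p + 1" "p - 1" n] pq by simp
  have wrap: "(phi_letter n ^^ 1) (j, n) = (1, j + 1)" for j
    by (simp add: phi_letter_def)
  have "(phi_letter n ^^ ((p - 1) + (1 + ((q - p - 1) + (1 + (n - q)))))) (p, q) = (p, q)"
    by (simp only: funpow_add o_apply 1 2 3 wrap)
  moreover have "(p - 1) + (1 + ((q - p - 1) + (1 + (n - q)))) = n"
    using pq by simp
  ultimately show ?thesis
    by (simp only: x)
qed

lemma phi_word_period:
  assumes "w \<in> lists (gens n)"
  shows "(phi_word n ^^ n) w = w"
proof -
  have "(phi_word n ^^ k) w = map (phi_letter n ^^ k) w" for k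
    by (induction k) (simp_all add: phi_word_def)
  then show ?thesis
    using assms phi_letter_period by (auto intro!: map_idI)
qed

lemma phi_pow_lists: "w \<in> lists (gens n) \<Longrightarrow> (phi_word n ^^ k) w \<in> lists (gens n)"
  by (induction k) (simp_all add: phi_word_lists del: in_lists_conv_set)

lemma dual_cong_phi_pow: "dual_cong n u v \<Longrightarrow> dual_cong n ((phi_word n ^^ k) u) ((phi_word n ^^ k) v)"
  by (induction k) (auto intro: dual_cong_phi)

lemma dual_cong_phi_iff:
  assumes "u \<in> lists (gens n)" "v \<in> lists (gens n)"
  shows "dual_cong n (phi_word n u) (phi_word n v) \<longleftrightarrow> dual_cong n u v"
proof
  assume *: "dual_cong n (phi_word n u) (phi_word n v)"
  show "dual_cong n u v"
  proof (cases n)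
    case 0
    then show ?thesis using assms dual_cong.refl[of "[]" 0] by (cases u; cases v) (auto simp: gens_def)
  next
    case (Suc m)
    have "dual_cong n ((phi_word n ^^ m) (phi_word n u)) ((phi_word n ^^ m) (phi_word n v))"
      by (rule dual_cong_phi_pow[OF *])
    then show ?thesis
      using phi_word_period[OF assms(1)] phi_word_period[OF assms(2)] Suc
      by (simp add: funpow_Suc_right del: funpow.simps)
  qed
qed (rule dual_cong_phi)

lemma phi_word_surj:
  assumes "w \<in> lists (gens n)"
  obtains u where "u \<in> lists (gens n)" "phi_word n u = w"
proof (cases n)
  case 0
  then show ?thesis using assms that[of "[]"] by (cases w) (auto simp: gens_def)
next
  case (Suc m)
  then show ?thesis
    using phi_word_period[OF assms] phi_pow_lists[OF assms, of m] that[of "(phi_word n ^^ m) w"] by simp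
qed

text \<open>The letters rotated into the smaller monoid are those other than \<open>(i, n - 1)\<close> and \<open>(n - 1, n)\<close>.\<close>

lemma trivial_tail_phi_iff:
  assumes "3 \<le> n" "w \<in> lists (gens n)"
  shows "trivial_tail n (phi_word n w) \<longleftrightarrow>
    (\<forall>u i j. dual_cong n w (u @ [(i, j)]) \<longrightarrow> j = n - 1 \<or> (i = n - 1 \<and> j = n))"
proof
  assume t: "trivial_tail n (phi_word n w)"
  show "\<forall>u i j. dual_cong n w (u @ [(i, j)]) \<longrightarrow> j = n - 1 \<or> (i = n - 1 \<and> j = n)"
  proof (intro allI impI)
    fix u i j assume u: "dual_cong n w (u @ [(i, j)])"
    have "(i, j) \<in> gens n" using dual_cong_lists[OF u] by simp
    moreover have "phi_letter n (i, j) \<notin> gens (n - 1)"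
      using dual_cong_phi[OF u] t unfolding trivial_tail_def by (auto simp: phi_word_def)
    ultimately show "j = n - 1 \<or> (i = n - 1 \<and> j = n)"
      by (auto simp: gens_def phi_letter_def split: if_splits)
  qed
next
  assume *: "\<forall>u i j. dual_cong n w (u @ [(i, j)]) \<longrightarrow> j = n - 1 \<or> (i = n - 1 \<and> j = n)"
  have False if u: "x \<in> gens (n - 1)" "dual_cong n (phi_word n w) (u @ [x])" for u x
  proof -
    obtain v where v: "v \<in> lists (gens n)" "phi_word n v = u @ [x]"
      using phi_word_surj dual_cong_lists[OF u(2)] by blast
    then obtain v' i j where v': "v = v' @ [(i, j)]" "phi_letter n (i, j) = x"
      by (auto simp: phi_word_def map_eq_append_conv)
    have "dual_cong n w (v' @ [(i, j)])"
      using u(2) v v' dual_cong_phi_iff[OF assms(2) v(1)] by simp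
    then have "j = n - 1 \<or> (i = n - 1 \<and> j = n)"
      using * by blast
    then show False
      using v' u(1) assms(1) by (auto simp: gens_def phi_letter_def split: if_splits)
  qed
  then show "trivial_tail n (phi_word n w)"
    using phi_word_lists[OF assms(2)] unfolding trivial_tail_def by blast
qed

text \<open>From here on, words are mostly handled as a whole, and membership in \<open>lists\<close> should not
be taken apart by the automation.\<close>

declare in_listsD [rule del] in_listsI [rule del]

section \<open>Splittings represented by words\<close>

lemma entry_snoc_1: "entry (xs @ [x]) 1 = x"
  by (simp add: entry_def)

lemma entry_take:
  assumes "1 \<le> i" "i + k \<le> length xs"
  shows "entry (take (length xs - k) xs) i = entry xs (i + k)"
  using assms by (simp add: entry_def add.commute)

lemma entry_map:
  assumes "1 \<le> k" "k \<le> length xs"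
  shows "entry (map f xs) k = f (entry xs k)"
  using assms by (simp add: entry_def)

lemma entry_length: "xs \<noteq> [] \<Longrightarrow> entry xs (length xs) = hd xs"
  by (simp add: entry_def hd_conv_nth)

lemma entry_in_set: "1 \<le> k \<Longrightarrow> k \<le> length xs \<Longrightarrow> entry xs k \<in> set xs"
  by (simp add: entry_def)

lemma map_add_upt_from: "map (\<lambda>i. i + k) [a..<b] = [a + k..<b + (k::nat)]"
  by (induction b) auto

lemma phi_word_concat: "phi_word n (concat us) = concat (map (phi_word n) us)"
  by (induction us) simp_all

text \<open>The braids whose tails are required to be trivial in the definition of the splitting are rotations of
the products of the prefixes of \<open>ws\<close>.\<close>

lemma phi_concat_take:
  assumes "k < length ws"
  shows "concat (map (\<lambda>j. (phi_word n ^^ (j - k)) (entry ws j)) (rev [k + 1..<length ws + 1])) =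
    phi_word n (phi_concat n (take (length ws - k) ws))"
proof -
  let ?b = "length ws"
  have "rev [k + 1..<?b + 1] = map (\<lambda>i. i + k) (rev [1..<?b - k + 1])"
    using assms map_add_upt_from[of k 1 "?b - k + 1"] by (simp add: rev_map[symmetric] add.commute)
  then have "map (\<lambda>j. (phi_word n ^^ (j - k)) (entry ws j)) (rev [k + 1..<?b + 1]) =
      map (\<lambda>i. (phi_word n ^^ i) (entry ws (i + k))) (rev [1..<?b - k + 1])"
    by simp
  also have "\<dots> = map (\<lambda>i. phi_word n ((phi_word n ^^ (i - 1)) (entry (take (?b - k) ws) i))) (rev [1..<?b - k + 1])"
  proof (rule map_cong[OF HOL.refl])
    fix i assume "i \<in> set (rev [1..<?b - k + 1])"
    then have i: "1 \<le> i" "i + k \<le> ?b" using assms by auto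
    then have "phi_word n ^^ i = phi_word n \<circ> (phi_word n ^^ (i - 1))"
      by (metis Suc_diff_1 funpow.simps(2) less_eq_Suc_le One_nat_def)
    then show "(phi_word n ^^ i) (entry ws (i + k)) =
        phi_word n ((phi_word n ^^ (i - 1)) (entry (take (?b - k) ws) i))"
      using entry_take[OF i] by simp
  qed
  finally show ?thesis
    by (simp add: phi_concat_def phi_word_concat comp_def)
qed

lemma phi_concat_Nil [simp]: "phi_concat n [] = []"
  by (simp add: phi_concat_def)

lemma phi_concat_snoc [simp]: "phi_concat n (ws @ [w]) = phi_word n (phi_concat n ws) @ w"
proof -
  have "rev [1..<length (ws @ [w]) + 1] = rev [1 + 1..<length (ws @ [w]) + 1] @ [1]"
    by (simp add: upt_rec del: upt_Suc)
  then have "phi_concat n (ws @ [w]) =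
      concat (map (\<lambda>j. (phi_word n ^^ (j - 1)) (entry (ws @ [w]) j)) (rev [1 + 1..<length (ws @ [w]) + 1]))
      @ entry (ws @ [w]) 1"
    unfolding phi_concat_def by (simp del: upt_Suc)
  also have "concat (map (\<lambda>j. (phi_word n ^^ (j - 1)) (entry (ws @ [w]) j)) (rev [1 + 1..<length (ws @ [w]) + 1]))
      = phi_word n (phi_concat n ws)"
  proof (cases "ws = []")
    case False
    then show ?thesis
      using phi_concat_take[of 1 "ws @ [w]" n] by simp
  qed simp
  finally show ?thesis
    using entry_snoc_1[of ws w] by simp
qed

lemma phi_concat_lists:
  assumes "set ws \<subseteq> lists (gens (n - 1))"
  shows "phi_concat n ws \<in> lists (gens n)"
  using assms
proof (induction ws rule: rev_induct)
  case (snoc w ws)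
  have "w \<in> lists (gens n)"
    using snoc.prems lists_mono[OF gens_mono[of "n - 1" n]] by simp blast
  then show ?case
    using snoc phi_word_lists by simp
qed simp

lemma phi_concat_eq_Nil:
  assumes "ws \<noteq> []" "hd ws \<noteq> []"
  shows "phi_concat n ws \<noteq> []"
  using assms
proof (induction ws rule: rev_induct)
  case (snoc w ws)
  then show ?case using phi_concat_snoc[of n "[]" w] by (cases "ws = []") auto
qed simp

lemma phi_concat_cong:
  assumes "list_all2 (dual_cong n) ws vs"
  shows "dual_cong n (phi_concat n ws) (phi_concat n vs)"
  using assms
proof (induction ws arbitrary: vs rule: rev_induct)
  case Nil
  then show ?case by (auto intro: dual_cong.refl)
next
  case (snoc w ws)
  then obtain v vs' where "vs = vs' @ [v]" "list_all2 (dual_cong n) ws vs'" "dual_cong n w v"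
    by (auto simp: list_all2_append1 list_all2_Cons1)
  then show ?case
    using snoc.IH by (auto intro: dual_cong_append dual_cong_phi)
qed

text \<open>The words \<open>ws\<close> represent the entries, listed from the left, of the splitting of the braid represented by
\<open>phi_concat n ws\<close>; see \<open>is_splitting_iff\<close>.\<close>

definition splitting_words :: "nat \<Rightarrow> word list \<Rightarrow> bool" where
  "splitting_words n ws \<longleftrightarrow> ws \<noteq> [] \<and> hd ws \<noteq> [] \<and> set ws \<subseteq> lists (gens (n - 1)) \<and>
    (\<forall>k. 1 \<le> k \<and> k < length ws \<longrightarrow> trivial_tail n (phi_word n (phi_concat n (take k ws))))"

lemma trivial_tail_Nil [simp]: "trivial_tail n []"
  unfolding trivial_tail_def using dual_cong_length by fastforce

lemma splitting_words_snoc: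
  assumes "ws \<noteq> []"
  shows "splitting_words n (ws @ [w]) \<longleftrightarrow> splitting_words n ws \<and> w \<in> lists (gens (n - 1)) \<and>
    trivial_tail n (phi_word n (phi_concat n ws))"
proof -
  have "(\<forall>k. 1 \<le> k \<and> k < length (ws @ [w]) \<longrightarrow> trivial_tail n (phi_word n (phi_concat n (take k (ws @ [w])))))
    \<longleftrightarrow> (\<forall>k. 1 \<le> k \<and> k < length ws \<longrightarrow> trivial_tail n (phi_word n (phi_concat n (take k ws)))) \<and>
      trivial_tail n (phi_word n (phi_concat n ws))"
    using assms by (auto simp: less_Suc_eq Suc_le_eq)
  then show ?thesis
    using assms unfolding splitting_words_def by auto
qed

lemma splitting_words_last:
  assumes "splitting_words n (ws @ [w])"
  shows "trivial_tail n (phi_word n (phi_concat n ws))"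
  using assms splitting_words_snoc[of ws n w] by (cases "ws = []") auto

text \<open>The last entry and the product of the others are determined by uniqueness of the tail
decomposition; since the rotation is injective, the other entries follow by induction.\<close>

lemma splitting_words_unique:
  assumes "splitting_words n ws" "splitting_words n vs" "dual_cong n (phi_concat n ws) (phi_concat n vs)"
  shows "list_all2 (dual_cong (n - 1)) ws vs"
  using assms
proof (induction ws arbitrary: vs rule: rev_induct)
  case Nil
  then show ?case by (simp add: splitting_words_def)
next
  case (snoc w ws)
  obtain v vs' where vs: "vs = vs' @ [v]"
    using snoc.prems(2) by (cases vs rule: rev_cases) (auto simp: splitting_words_def)
  have l: "w \<in> lists (gens (n - 1))" "v \<in> lists (gens (n - 1))"
    "phi_concat n ws \<in> lists (gens n)" "phi_concat n vs' \<in> lists (gens n)"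
    using snoc.prems vs phi_concat_lists[of ws n] phi_concat_lists[of vs' n]
    by (auto simp: splitting_words_def simp del: in_lists_conv_set)
  have "dual_cong n (phi_word n (phi_concat n ws) @ w) (phi_word n (phi_concat n vs') @ v)"
    using snoc.prems(3) vs by simp
  then have *: "dual_cong n (phi_word n (phi_concat n ws)) (phi_word n (phi_concat n vs'))"
      "dual_cong (n - 1) w v"
    using tail_unique[OF splitting_words_last[OF snoc.prems(1)] splitting_words_last[OF snoc.prems(2)[unfolded vs]]] l
    by blast+
  have c: "dual_cong n (phi_concat n ws) (phi_concat n vs')"
    using *(1) dual_cong_phi_iff l by blast
  have "ws = [] \<longleftrightarrow> vs' = []"
    using dual_cong_length[OF c] phi_concat_eq_Nil[of ws n] phi_concat_eq_Nil[of vs' n] snoc.prems vs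
    by (auto simp: splitting_words_def hd_append split: if_splits)
  then have "list_all2 (dual_cong (n - 1)) ws vs'"
    using snoc.IH[OF _ _ c] splitting_words_snoc snoc.prems vs by (cases "ws = []") auto
  then show ?case
    using *(2) vs by (simp add: list_all2_appendI)
qed

lemma splitting_words_cong:
  assumes "splitting_words n ws" "list_all2 (dual_cong (n - 1)) ws vs"
  shows "splitting_words n vs"
proof -
  have len: "length ws = length vs" using assms(2) by (rule list_all2_lengthD)
  have n: "list_all2 (dual_cong n) ws vs"
    using assms(2) by (rule list_all2_mono) (auto intro: dual_cong_mono)
  have "trivial_tail n (phi_word n (phi_concat n (take k vs)))" if "1 \<le> k" "k < length vs" for k
  proof -
    have "dual_cong n (phi_concat n (take k ws)) (phi_concat n (take k vs))"
      using n by (intro phi_concat_cong list_all2_takeI)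
    moreover have "trivial_tail n (phi_word n (phi_concat n (take k ws)))"
      using assms(1) that len unfolding splitting_words_def by auto
    ultimately show ?thesis
      using trivial_tail_cong dual_cong_phi by blast
  qed
  moreover have "hd vs \<noteq> []" "vs \<noteq> []"
    using assms by (cases ws; cases vs; auto simp: splitting_words_def dest: dual_cong_length)+
  moreover have "set vs \<subseteq> lists (gens (n - 1))"
  proof
    fix v assume "v \<in> set vs"
    then obtain w where "dual_cong (n - 1) w v"
      using assms(2) by (metis in_set_conv_nth list_all2_conv_all_nth)
    then show "v \<in> lists (gens (n - 1))"
      using dual_cong_lists by blast
  qed
  ultimately show ?thesis
    unfolding splitting_words_def by blast
qed

text \<open>Splitting off a tail and rotating back either shortens the word or, if the tail is trivial, leaves its
length unchanged. The latter can happen at most twice in a row: a final letter \<open>(p, n)\<close> with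
\<open>p \<noteq> 1\<close> is rotated back into the smaller monoid at once, and \<open>(1, n)\<close> is rotated back first to
\<open>(n - 1, n)\<close> and then to \<open>(n - 2, n - 1)\<close>.\<close>

lemma ex_splitting_words:
  assumes "3 \<le> n" "w \<in> lists (gens n)" "w \<noteq> []"
  shows "\<exists>ws. splitting_words n ws \<and> dual_cong n w (phi_concat n ws)"
  using assms(2,3)
proof (induction "length w" arbitrary: w rule: less_induct)
  case less
  let ?E = "\<lambda>w. \<exists>ws. splitting_words n ws \<and> dual_cong n w (phi_concat n ws)"
  \<comment> \<open>A splitting of \<open>Q\<close> and a tail \<open>g\<close> give a splitting of the rotation of \<open>Q\<close> followed by \<open>g\<close>.\<close>
  have extend: "?E (phi_word n Q @ g)"
    if Q: "?E Q" "trivial_tail n (phi_word n Q)" "g \<in> lists (gens (n - 1))" for Q g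
  proof -
    obtain ws where ws: "splitting_words n ws" "dual_cong n Q (phi_concat n ws)"
      using Q(1) by blast
    have phi: "dual_cong n (phi_word n Q) (phi_word n (phi_concat n ws))"
      by (rule dual_cong_phi[OF ws(2)])
    have "g \<in> lists (gens n)"
      using Q(3) lists_mono[OF gens_mono[of "n - 1" n]] by auto
    then have "dual_cong n (phi_word n Q @ g) (phi_concat n (ws @ [g]))"
      using dual_cong_appendR[OF phi] by simp
    moreover have "splitting_words n (ws @ [g])"
      using ws(1) Q(3) trivial_tail_cong[OF Q(2) phi] splitting_words_snoc[of ws n g]
      by (auto simp: splitting_words_def simp del: in_lists_conv_set)
    ultimately show ?thesis by blast
  qed
  \<comment> \<open>A nontrivial tail is split off, and the rest is shorter than \<open>w\<close>.\<close>
  have shorten: "?E v" if v: "length v = length w" "v \<in> lists (gens n)" "\<not> trivial_tail n v" for v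
  proof -
    obtain P g where Pg: "trivial_tail n P" "g \<in> lists (gens (n - 1))" "dual_cong n v (P @ g)"
      using ex_tail[OF v(2)] by blast
    have g: "g \<noteq> []"
      using v(3) Pg(1) trivial_tail_cong[OF Pg(1) dual_cong.sym, of v] Pg(3) by auto
    show ?thesis
    proof (cases "P = []")
      case True
      then have "splitting_words n [g]" "dual_cong n v (phi_concat n [g])"
        using Pg g phi_concat_snoc[of n "[]" g] by (auto simp: splitting_words_def)
      then show ?thesis by blast
    next
      case False
      obtain Q where Q: "Q \<in> lists (gens n)" "phi_word n Q = P"
        using phi_word_surj[of P n] Pg(1) unfolding trivial_tail_def by blast
      have "length Q = length P"
        using Q(2) by (auto simp: phi_word_def)
      then have "length Q < length w" "Q \<noteq> []"
        using dual_cong_length[OF Pg(3)] v(1) g False Q(2) by auto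
      then have "?E Q"
        using less.hyps Q(1) by blast
      then obtain ws where "splitting_words n ws" "dual_cong n (P @ g) (phi_concat n ws)"
        using extend[of Q g] Pg Q(2) by blast
      then show ?thesis
        using dual_cong.trans[OF Pg(3)] by blast
    qed
  qed
  show ?case
  proof (cases "trivial_tail n w")
    case False
    then show ?thesis using shorten[of w] less.prems by blast
  next
    case w: True
    obtain w1 where w1: "w1 \<in> lists (gens n)" "phi_word n w1 = w"
      using phi_word_surj[OF less.prems(1)] by blast
    have len1: "length w1 = length w" using w1(2) by (auto simp: phi_word_def)
    have "?E w1"
    proof (cases "trivial_tail n w1")
      case False
      then show ?thesis using shorten[of w1] w1 len1 by blast
    next
      case t1: True
      obtain w2 where w2: "w2 \<in> lists (gens n)" "phi_word n w2 = w1"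
        using phi_word_surj[OF w1(1)] by blast
      have len2: "length w2 = length w" using w2(2) len1 by (auto simp: phi_word_def)
      have "w1 \<noteq> []" "w2 \<noteq> []" using less.prems(2) w1(2) w2(2) by auto
      then have last: "last w1 = phi_letter n (last w2)" "last w = phi_letter n (last w1)"
        using w1(2) w2(2) by (auto simp: phi_word_def last_map)
      obtain i where i: "last w1 = (i, n)" "(i, n) \<in> gens n"
        using trivial_tail_last[OF t1 \<open>w1 \<noteq> []\<close>] by metis
      have "last w = (fst (last w), n)"
        using trivial_tail_last[OF w less.prems(2)] by blast
      then have "i = n - 1"
        using i last(2) by (auto simp: phi_letter_def)
      moreover have "last w2 \<in> gens n"
        using w2(1) last_in_set[OF \<open>w2 \<noteq> []\<close>] by (auto simp: in_lists_conv_set)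
      ultimately have "last w2 \<in> gens (n - 1)"
        using i(1) last(1) assms(1) by (cases "last w2") (auto simp: phi_letter_def gens_def split: if_splits)
      then have "snd (last w2) \<noteq> n"
        using assms(1) by (auto simp: gens_def)
      then have "\<not> trivial_tail n w2"
        using trivial_tail_last[OF _ \<open>w2 \<noteq> []\<close>, of n] by (metis snd_conv)
      then show ?thesis
        using extend[of w2 "[]"] shorten[of w2] w2 len2 t1 by auto
    qed
    then show ?thesis
      using extend[of w1 "[]"] w w1(2) by auto
  qed
qed

section \<open>Splittings of braids\<close>

lemma right_divisor_braid_of:
  assumes "d \<in> lists (gens n)" "w \<in> lists (gens n)"
  shows "right_divisor n (braid_of n d) (braid_of n w) \<longleftrightarrow> (\<exists>u. dual_cong n w (u @ d))"
proof
  assume "right_divisor n (braid_of n d) (braid_of n w)"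
  then obtain u where "u \<in> lists (gens n)" "braid_of n w = braid_of n u \<otimes>\<^bsub>dual_braid_monoid n\<^esub> braid_of n d"
    unfolding right_divisor_def carrier_dual_braid_monoid by blast
  then show "\<exists>u. dual_cong n w (u @ d)"
    using mult_braid_of[of u n d] assms braid_of_eq_iff[OF assms(2)] by auto
next
  assume "\<exists>u. dual_cong n w (u @ d)"
  then obtain u where u: "dual_cong n w (u @ d)" by blast
  then have "u \<in> lists (gens n)" using dual_cong_lists by fastforce
  then have "braid_of n u \<in> carrier (dual_braid_monoid n)"
      "braid_of n w = braid_of n u \<otimes>\<^bsub>dual_braid_monoid n\<^esub> braid_of n d"
    using mult_braid_of[of u n d] assms braid_of_eq_iff[OF assms(2)] u
    by (auto simp: carrier_dual_braid_monoid simp del: in_lists_conv_set)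
  then show "right_divisor n (braid_of n d) (braid_of n w)"
    unfolding right_divisor_def by blast
qed

lemma is_tail_one_iff:
  assumes "w \<in> lists (gens n)"
  shows "is_tail n \<one>\<^bsub>dual_braid_monoid n\<^esub> (braid_of n w) \<longleftrightarrow> trivial_tail n w"
proof -
  have sub: "lists (gens (n - 1)) \<subseteq> lists (gens n)"
    by (intro lists_mono gens_mono) simp
  have carrier: "carrier (dual_braid_monoid (n - 1)) = braid_of n ` lists (gens (n - 1))"
    by (rule dual_braid_monoid_submonoid) simp
  have nil: "[] \<in> lists (gens k)" for k by simp
  have "is_tail n \<one>\<^bsub>dual_braid_monoid n\<^esub> (braid_of n w) \<longleftrightarrow>
    (\<forall>d\<in>lists (gens (n - 1)). (\<exists>u. dual_cong n w (u @ d)) \<longrightarrow> (\<exists>u. dual_cong n [] (u @ d)))"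
    unfolding is_tail_def one_dual_braid_monoid carrier
    using right_divisor_braid_of[OF nil assms] dual_cong.refl[OF assms] sub nil
      right_divisor_braid_of[OF _ assms] right_divisor_braid_of[OF _ nil, of _ n]
    by (auto simp del: in_lists_conv_set simp: subset_iff)
  also have "\<dots> \<longleftrightarrow> trivial_tail n w"
  proof
    assume *: "\<forall>d\<in>lists (gens (n - 1)). (\<exists>u. dual_cong n w (u @ d)) \<longrightarrow> (\<exists>u. dual_cong n [] (u @ d))"
    have "\<not> dual_cong n w (u @ [x])" if "x \<in> gens (n - 1)" for u x
      using *[THEN bspec[of _ _ "[x]"]] that dual_cong_length[of n "[]"] by fastforce
    then show "trivial_tail n w"
      using assms unfolding trivial_tail_def by blast
  next
    assume t: "trivial_tail n w"
    have "dual_cong n [] ([] @ [])" by (simp add: dual_cong.refl)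
    then show "\<forall>d\<in>lists (gens (n - 1)). (\<exists>u. dual_cong n w (u @ d)) \<longrightarrow> (\<exists>u. dual_cong n [] (u @ d))"
      using trivial_tail_factor[OF t] by blast
  qed
  finally show ?thesis .
qed

lemma braid_prod_braid_of:
  assumes "set us \<subseteq> lists (gens n)"
  shows "braid_prod n (map (braid_of n) us) = braid_of n (concat us)"
  using assms
proof (induction us)
  case (Cons u us)
  have "concat us \<in> lists (gens n)" "u \<in> lists (gens n)"
    using Cons.prems by (auto simp: in_lists_conv_set)
  then show ?case
    using Cons mult_braid_of by (simp add: braid_prod_def)
qed (simp add: braid_prod_def one_dual_braid_monoid)

lemma phi_braid_pow:
  assumes "w \<in> lists (gens n)"
  shows "(phi_braid n ^^ k) (braid_of n w) = braid_of n ((phi_word n ^^ k) w)"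
  using assms phi_pow_lists[OF assms] by (induction k) (simp_all add: phi_braid_of del: in_lists_conv_set)

lemma is_splitting_iff:
  assumes ws: "set ws \<subseteq> lists (gens (n - 1))"
  shows "is_splitting n \<beta> (map (braid_of n) ws) \<longleftrightarrow>
    splitting_words n ws \<and> \<beta> = braid_of n (phi_concat n ws)"
proof (cases "ws = []")
  case True
  then show ?thesis by (simp add: is_splitting_def splitting_words_def)
next
  case False
  let ?b = "length ws"
  have sub: "lists (gens (n - 1)) \<subseteq> lists (gens n)"
    by (intro lists_mono gens_mono) simp
  have entry: "entry ws j \<in> lists (gens n)" if "1 \<le> j" "j \<le> ?b" for j
    using entry_in_set[OF that] ws sub by blast
  have prod: "braid_prod n (map (\<lambda>j. (phi_braid n ^^ (j - k)) (entry (map (braid_of n) ws) j)) (rev [a..<?b + 1]))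
    = braid_of n (concat (map (\<lambda>j. (phi_word n ^^ (j - k)) (entry ws j)) (rev [a..<?b + 1])))"
    if a: "1 \<le> a" for a k
  proof -
    have "map (\<lambda>j. (phi_braid n ^^ (j - k)) (entry (map (braid_of n) ws) j)) (rev [a..<?b + 1])
      = map (\<lambda>j. braid_of n ((phi_word n ^^ (j - k)) (entry ws j))) (rev [a..<?b + 1])"
    proof (rule map_cong[OF HOL.refl])
      fix j assume "j \<in> set (rev [a..<?b + 1])"
      then have "1 \<le> j" "j \<le> ?b" using a by auto
      then show "(phi_braid n ^^ (j - k)) (entry (map (braid_of n) ws) j) =
          braid_of n ((phi_word n ^^ (j - k)) (entry ws j))"
        using entry_map phi_braid_pow[OF entry] by metis
    qed
    moreover have "set (map (\<lambda>j. (phi_word n ^^ (j - k)) (entry ws j)) (rev [a..<?b + 1])) \<subseteq> lists (gens n)"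
    proof
      fix v assume "v \<in> set (map (\<lambda>j. (phi_word n ^^ (j - k)) (entry ws j)) (rev [a..<?b + 1]))"
      then obtain j where "v = (phi_word n ^^ (j - k)) (entry ws j)" "1 \<le> j" "j \<le> ?b"
        using a by auto
      then show "v \<in> lists (gens n)"
        using phi_pow_lists[OF entry] by blast
    qed
    ultimately show ?thesis
      using braid_prod_braid_of[of "map (\<lambda>j. (phi_word n ^^ (j - k)) (entry ws j)) (rev [a..<?b + 1])" n]
      by (simp only: map_map comp_def)
  qed
  have carrier: "set (map (braid_of n) ws) \<subseteq> carrier (dual_braid_monoid (n - 1))"
    using ws dual_braid_monoid_submonoid(1)[of "n - 1" n] by auto
  have hd: "entry (map (braid_of n) ws) ?b \<noteq> \<one>\<^bsub>dual_braid_monoid n\<^esub> \<longleftrightarrow> hd ws \<noteq> []"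
  proof -
    have "entry (map (braid_of n) ws) ?b = braid_of n (hd ws)"
      using False entry_length[of "map (braid_of n) ws"] by (simp add: hd_map)
    moreover have "hd ws \<in> lists (gens n)"
      using ws sub hd_in_set[OF False] by blast
    ultimately show ?thesis
      using braid_of_eq_iff[of "hd ws" n "[]"] dual_cong_length[of n "hd ws" "[]"] dual_cong.refl[of "[]" n]
      by (auto simp: one_dual_braid_monoid)
  qed
  have tail: "(\<forall>k. 1 \<le> k \<and> k < ?b \<longrightarrow> is_tail n \<one>\<^bsub>dual_braid_monoid n\<^esub>
      (braid_of n (concat (map (\<lambda>j. (phi_word n ^^ (j - k)) (entry ws j)) (rev [k + 1..<?b + 1]))))) \<longleftrightarrow>
    (\<forall>k. 1 \<le> k \<and> k < ?b \<longrightarrow> trivial_tail n (phi_word n (phi_concat n (take k ws))))"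
    (is "(\<forall>k. ?K k \<longrightarrow> ?T k) \<longleftrightarrow> (\<forall>k. ?K k \<longrightarrow> ?U k)")
  proof -
    have TU: "?T k \<longleftrightarrow> ?U (?b - k)" if "?K k" for k
    proof -
      have "set (take (?b - k) ws) \<subseteq> lists (gens (n - 1))"
        using ws set_take_subset by fast
      then have "phi_word n (phi_concat n (take (?b - k) ws)) \<in> lists (gens n)"
        using phi_concat_lists phi_word_lists by blast
      then show ?thesis
        using that is_tail_one_iff phi_concat_take[of k ws n] by simp
    qed
    show ?thesis
    proof (intro iffI allI impI)
      fix k assume T: "\<forall>k. ?K k \<longrightarrow> ?T k" and k': "?K k"
      have k: "?K (?b - k)" "?b - (?b - k) = k" using k' by auto
      have "?T (?b - k)" using T k(1) by blast
      then have "?U (?b - (?b - k))" using TU[OF k(1)] by blast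
      then show "?U k" unfolding k(2) .
    next
      fix k assume U: "\<forall>k. ?K k \<longrightarrow> ?U k" and k: "?K k"
      have "?K (?b - k)" using k by auto
      then have "?U (?b - k)" using U by blast
      then show "?T k" using TU[OF k] by blast
    qed
  qed
  have prod_all: "braid_prod n (map (\<lambda>k. (phi_braid n ^^ (k - 1)) (entry (map (braid_of n) ws) k)) (rev [1..<?b + 1]))
    = braid_of n (phi_concat n ws)"
    unfolding prod[of 1 1, OF order_refl] phi_concat_def ..
  have prod_tail: "braid_prod n (map (\<lambda>j. (phi_braid n ^^ (j - k)) (entry (map (braid_of n) ws) j)) (rev [k + 1..<?b + 1]))
    = braid_of n (concat (map (\<lambda>j. (phi_word n ^^ (j - k)) (entry ws j)) (rev [k + 1..<?b + 1])))" for k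
    by (rule prod) simp
  have "1 \<le> ?b" using False by (simp add: Suc_le_eq)
  then show ?thesis
    unfolding is_splitting_def Let_def splitting_words_def length_map prod_all prod_tail hd tail
    using False ws carrier by blast
qed

lemma ex_words_of_braids:
  assumes "set Xs \<subseteq> carrier (dual_braid_monoid (n - 1))"
  obtains ws where "Xs = map (braid_of n) ws" "set ws \<subseteq> lists (gens (n - 1))"
proof -
  have "Xs \<in> lists (braid_of n ` lists (gens (n - 1)))"
    using assms dual_braid_monoid_submonoid(1)[of "n - 1" n] by (auto simp: in_lists_conv_set)
  then obtain ws where "Xs = map (braid_of n) ws" "ws \<in> lists (lists (gens (n - 1)))"
    unfolding lists_image by (rule imageE)
  then show ?thesis
    using that by (simp add: lists_eq_set)
qed

lemma splitting_braid_of: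
  assumes "splitting_words n ws"
  shows "splitting n (braid_of n (phi_concat n ws)) = map (braid_of n) ws"
  unfolding splitting_def
proof (rule the_equality)
  have ws: "set ws \<subseteq> lists (gens (n - 1))"
    using assms by (simp add: splitting_words_def)
  show "is_splitting n (braid_of n (phi_concat n ws)) (map (braid_of n) ws)"
    using is_splitting_iff[OF ws] assms by blast
  fix Xs assume X: "is_splitting n (braid_of n (phi_concat n ws)) Xs"
  then have "set Xs \<subseteq> carrier (dual_braid_monoid (n - 1))"
    by (simp add: is_splitting_def Let_def)
  then obtain vs where vs: "Xs = map (braid_of n) vs" "set vs \<subseteq> lists (gens (n - 1))"
    by (rule ex_words_of_braids)
  have "splitting_words n vs" "braid_of n (phi_concat n ws) = braid_of n (phi_concat n vs)"
    using X unfolding vs(1) is_splitting_iff[OF vs(2)] by blast+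
  then have "splitting_words n vs" "dual_cong n (phi_concat n ws) (phi_concat n vs)"
    unfolding braid_of_eq_iff[OF phi_concat_lists[OF ws]] .
  then have "list_all2 (dual_cong (n - 1)) ws vs"
    using splitting_words_unique[OF assms] by blast
  then have "list_all2 (\<lambda>w v. braid_of n w = braid_of n v) ws vs"
  proof (rule list_all2_mono)
    fix w v assume "dual_cong (n - 1) w v"
    then have "dual_cong n w v" by (rule dual_cong_mono) simp
    then show "braid_of n w = braid_of n v"
      using braid_of_eq_iff dual_cong_lists by blast
  qed
  then have "map (braid_of n) ws = map (braid_of n) vs"
    by (simp add: list_all2_conv_all_nth list_eq_iff_nth_eq)
  then show "Xs = map (braid_of n) ws"
    using vs(1) by simp
qed

section \<open>Rotating words and splittings\<close>

lemma rnf_phi_concat: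
  assumes "3 \<le> n" "splitting_words n ws"
  shows "rnf n (braid_of n (phi_concat n ws)) = phi_concat n (map (\<lambda>w. rnf (n - 1) (braid_of (n - 1) w)) ws)"
proof -
  have ws: "set ws \<subseteq> lists (gens (n - 1))" "phi_concat n ws \<noteq> []"
    using assms phi_concat_eq_Nil by (auto simp: splitting_words_def)
  have "braid_of n (phi_concat n ws) \<noteq> \<one>\<^bsub>dual_braid_monoid n\<^esub>"
    unfolding one_dual_braid_monoid braid_of_eq_iff[OF phi_concat_lists[OF ws(1)]]
    using dual_cong_length[of n "phi_concat n ws" "[]"] ws(2) by auto
  then have "rnf n (braid_of n (phi_concat n ws)) =
      phi_concat n (map (rnf (n - 1)) (map (braid_of n) ws))"
    using assms splitting_braid_of by (subst rnf.simps) simp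
  also have "map (rnf (n - 1)) (map (braid_of n) ws) = map (\<lambda>w. rnf (n - 1) (braid_of (n - 1) w)) ws"
    using ws(1) braid_of_restrict[of _ "n - 1" n] by (auto simp del: in_lists_conv_set)
  finally show ?thesis .
qed

lemma rnf_one:
  assumes "3 \<le> n"
  shows "rnf n (braid_of n []) = []"
  using assms by (subst rnf.simps) (simp add: one_dual_braid_monoid)

lemma words_two:
  assumes "w \<in> lists (gens 2)"
  shows "w = replicate (length w) (1, 2)"
  using assms by (intro replicate_eqI) (fastforce simp: gens_def in_lists_conv_set)+

lemma rnf_two:
  assumes "w \<in> lists (gens 2)"
  shows "rnf 2 (braid_of 2 w) = w"
proof (subst rnf.simps, simp, rule the_equality)
  show "w \<in> braid_of 2 w \<and> (\<exists>k. w = replicate k (Suc 0, 2))"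
    using words_two[OF assms] dual_cong.refl[OF assms] by (auto simp: braid_of_def)
  fix v assume "v \<in> braid_of 2 w \<and> (\<exists>k. v = replicate k (Suc 0, 2))"
  then show "v = w"
    using words_two[OF assms] dual_cong_length[of 2 w v] by (auto simp: braid_of_def)
qed

lemma rnf_correct:
  assumes "2 \<le> n" "w \<in> lists (gens n)"
  shows "dual_cong n w (rnf n (braid_of n w))"
  using assms
proof (induction n arbitrary: w rule: dec_induct)
  case base
  then show ?case using rnf_two dual_cong.refl by simp
next
  case (step n)
  show ?case
  proof (cases "w = []")
    case True
    then show ?thesis using step.hyps rnf_one[of "Suc n"] by (auto intro: dual_cong.refl)
  next
    case False
    obtain ws where ws: "splitting_words (Suc n) ws" "dual_cong (Suc n) w (phi_concat (Suc n) ws)"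
      using ex_splitting_words[of "Suc n" w] step False by auto
    have "list_all2 (dual_cong n) ws (map (\<lambda>w. rnf n (braid_of n w)) ws)"
      using ws(1) step.IH by (auto simp: splitting_words_def list_all2_conv_all_nth subset_iff simp del: in_lists_conv_set)
    then have "list_all2 (dual_cong (Suc n)) ws (map (\<lambda>w. rnf n (braid_of n w)) ws)"
      by (rule list_all2_mono) (auto intro: dual_cong_mono)
    then have "dual_cong (Suc n) (phi_concat (Suc n) ws) (phi_concat (Suc n) (map (\<lambda>w. rnf n (braid_of n w)) ws))"
      by (rule phi_concat_cong)
    moreover have "braid_of (Suc n) w = braid_of (Suc n) (phi_concat (Suc n) ws)"
      using ws(2) braid_of_eq_iff[OF step.prems] by blast
    ultimately show ?thesis
      using rnf_phi_concat[OF _ ws(1)] step.hyps dual_cong.trans[OF ws(2)] by simp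
  qed
qed

lemma rotating_iff:
  assumes "2 \<le> n"
  shows "rotating n w \<longleftrightarrow> w \<in> lists (gens n) \<and> rnf n (braid_of n w) = w"
proof
  assume "rotating n w"
  then obtain v where v: "v \<in> lists (gens n)" "w = rnf n (braid_of n v)"
    unfolding rotating_def carrier_dual_braid_monoid by blast
  then have "dual_cong n v w"
    using rnf_correct[OF assms] by blast
  then show "w \<in> lists (gens n) \<and> rnf n (braid_of n w) = w"
    using v braid_of_eq_iff[OF v(1), of w] dual_cong_lists by auto
next
  assume "w \<in> lists (gens n) \<and> rnf n (braid_of n w) = w"
  then show "rotating n w"
    unfolding rotating_def carrier_dual_braid_monoid by (metis imageI)
qed

text \<open>The recursive definition of the normal form, unfolded once and freed of definite descriptions. The
empty word is listed separately because the trivial braid has no splitting.\<close>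

lemma rotating_iff_splitting_words:
  assumes "3 \<le> n"
  shows "rotating n w \<longleftrightarrow> w = [] \<or>
    (\<exists>ws. splitting_words n ws \<and> (\<forall>v\<in>set ws. rotating (n - 1) v) \<and> w = phi_concat n ws)"
proof
  assume "rotating n w"
  then have w: "w \<in> lists (gens n)" "rnf n (braid_of n w) = w"
    using rotating_iff assms by auto
  show "w = [] \<or> (\<exists>ws. splitting_words n ws \<and> (\<forall>v\<in>set ws. rotating (n - 1) v) \<and> w = phi_concat n ws)"
  proof (cases "w = []")
    case False
    obtain ws where ws: "splitting_words n ws" "dual_cong n w (phi_concat n ws)"
      using ex_splitting_words[OF assms w(1) False] by blast
    let ?r = "\<lambda>w. rnf (n - 1) (braid_of (n - 1) w)"
    have l: "v \<in> lists (gens (n - 1))" if "v \<in> set ws" for v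
      using ws(1) that by (auto simp: splitting_words_def simp del: in_lists_conv_set)
    have "list_all2 (dual_cong (n - 1)) ws (map ?r ws)"
      using l rnf_correct[of "n - 1"] assms by (auto simp: list_all2_conv_all_nth simp del: in_lists_conv_set)
    then have "splitting_words n (map ?r ws)"
      by (rule splitting_words_cong[OF ws(1)])
    moreover have "braid_of n w = braid_of n (phi_concat n ws)"
      using ws(2) braid_of_eq_iff[OF w(1)] by blast
    then have "w = phi_concat n (map ?r ws)"
      using w(2) rnf_phi_concat[OF assms ws(1)] by simp
    moreover have "rotating (n - 1) v" if "v \<in> set (map ?r ws)" for v
      using that l unfolding rotating_def carrier_dual_braid_monoid by auto
    ultimately show ?thesis by blast
  qed simp
next
  assume "w = [] \<or> (\<exists>ws. splitting_words n ws \<and> (\<forall>v\<in>set ws. rotating (n - 1) v) \<and> w = phi_concat n ws)"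
  then show "rotating n w"
  proof
    assume "w = []"
    then show ?thesis using rnf_one[OF assms] rotating_iff[of n w] assms by simp
  next
    assume "\<exists>ws. splitting_words n ws \<and> (\<forall>v\<in>set ws. rotating (n - 1) v) \<and> w = phi_concat n ws"
    then obtain ws where ws: "splitting_words n ws" "\<forall>v\<in>set ws. rotating (n - 1) v" "w = phi_concat n ws"
      by blast
    have "map (\<lambda>w. rnf (n - 1) (braid_of (n - 1) w)) ws = ws"
      using ws(2) rotating_iff[of "n - 1"] assms by (intro map_idI) auto
    then show ?thesis
      using rnf_phi_concat[OF assms ws(1)] ws phi_concat_lists[of ws n] rotating_iff[of n w] assms
      by (auto simp: splitting_words_def simp del: in_lists_conv_set)
  qed
qed

section \<open>Barriers and trivial tails\<close>

text \<open>For a word on m strands, the condition that the last letter involves the last strand. For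
nonempty rotating words it amounts to having a trivial tail.\<close>

definition ends_in :: "nat \<Rightarrow> word \<Rightarrow> bool" where
  "ends_in m v \<longleftrightarrow> v \<noteq> [] \<and> snd (last v) = m"

text \<open>The conditions of the theorem on last letters and barriers, with the entries counted from the
left: position \<open>i\<close> is the entry with number \<open>length ws - i\<close>. The barrier condition is stated for the only
possible index \<open>p\<close>, which is read off the last letter.\<close>

definition rotating_conditions :: "nat \<Rightarrow> word list \<Rightarrow> bool" where
  "rotating_conditions n ws \<longleftrightarrow>
    (\<forall>i. i + 3 \<le> length ws \<longrightarrow> ends_in (n - 1) (ws ! i)) \<and>
    (2 \<le> length ws \<longrightarrow> ws ! (length ws - 2) = [] \<and> length ws \<noteq> 2 \<or> ends_in (n - 1) (ws ! (length ws - 2))) \<and>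
    (\<forall>i. i + 3 \<le> length ws \<longrightarrow> fst (last (ws ! i)) + 1 \<noteq> n - 1 \<longrightarrow>
      contains_barrier n (fst (last (ws ! i)) + 1) (ws ! (i + 1)))"

text \<open>In the first alternative the trace of every index below \<open>m\<close> ends up to the left of \<open>p\<close>, in the
second the letter \<open>(p, m + 1)\<close> can be pushed through \<open>w\<close>. For arbitrary words barriers do not
decide between the two: if \<open>r < p < m\<close>, the word \<open>[(r, p), (p, m)]\<close> contains no barrier for \<open>p\<close>, and
yet its traces end up to the left of \<open>p\<close>.\<close>

definition barrier_dichotomy :: "nat \<Rightarrow> bool" where
  "barrier_dichotomy m \<longleftrightarrow> (\<forall>w p. rotating m w \<and> ends_in m w \<and> 2 \<le> p \<and> p < m \<longrightarrow>
    (if contains_barrier (m + 1) p w then trace w (m - 1) < p else (\<forall>(r, s)\<in>set w. p \<le> r)))"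

lemma rotating_Nil:
  assumes "2 \<le> n"
  shows "rotating n []"
proof (cases "n = 2")
  case True
  then show ?thesis using rnf_two[of "[]"] rotating_iff[of 2 "[]"] by simp
next
  case False
  then show ?thesis using rotating_iff_splitting_words[of n "[]"] assms by simp
qed

lemma rotating_lists: "2 \<le> n \<Longrightarrow> rotating n w \<Longrightarrow> w \<in> lists (gens n)"
  using rotating_iff by blast

lemma last_in_gens: "w \<in> lists (gens n) \<Longrightarrow> w \<noteq> [] \<Longrightarrow> last w \<in> gens n"
  by (simp add: in_lists_conv_set)

lemma last_phi_word: "w \<noteq> [] \<Longrightarrow> last (phi_word n w) = phi_letter n (last w)"
  by (simp add: phi_word_def last_map)

lemma ends_in_phi:
  assumes "ends_in (n - 1) w" "2 \<le> n"
  shows "last (phi_word n w) = (fst (last w) + 1, n)"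
  using assms by (cases "last w") (auto simp: ends_in_def last_phi_word phi_letter_def)

lemma rotating_trivial_tail:
  assumes "2 \<le> m" "rotating m v" "ends_in m v"
  shows "trivial_tail m v"
proof (cases "m = 2")
  case True
  have "gens 1 = {}" by (auto simp: gens_def)
  then show ?thesis
    using True rotating_lists[OF assms(1,2)] by (simp add: trivial_tail_def)
next
  case False
  then have m: "3 \<le> m" using assms(1) by simp
  obtain ws where ws: "splitting_words m ws" "v = phi_concat m ws"
    using rotating_iff_splitting_words[OF m, of v] assms(2,3) by (auto simp: ends_in_def)
  then obtain us x where us: "ws = us @ [x]"
    by (cases ws rule: rev_cases) (auto simp: splitting_words_def)
  have x: "x \<in> lists (gens (m - 1))"
    using ws(1) us by (simp add: splitting_words_def)
  have "x = []"
  proof (rule ccontr)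
    assume "x \<noteq> []"
    then have "last v \<in> gens (m - 1)"
      using last_in_gens[OF x] ws(2) us by simp
    then show False
      using assms(3) m by (auto simp: ends_in_def gens_def)
  qed
  then show ?thesis
    using splitting_words_last ws us by simp
qed

lemma ends_in_if_trivial_tail:
  assumes "3 \<le> n" "v \<in> lists (gens (n - 1))" "v \<noteq> []" "trivial_tail n (phi_word n (P @ v))"
  shows "ends_in (n - 1) v"
proof -
  have "phi_word n (P @ v) \<noteq> []" using assms(3) by simp
  then have "last (phi_word n (P @ v)) = (fst (last (phi_word n (P @ v))), n)"
    using trivial_tail_last[OF assms(4)] by blast
  then have "snd (phi_letter n (last v)) = n"
    using assms(3) last_phi_word[of "P @ v" n] by (metis append_is_Nil_conv last_appendR snd_conv)
  then show ?thesis
    using last_in_gens[OF assms(2,3)] assms(1,3)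
    by (cases "last v") (auto simp: ends_in_def phi_letter_def gens_def split: if_splits)
qed

text \<open>Without a barrier the last letter of \<open>P\<close> can be pushed to the end of \<open>P @ v\<close>, where the rotation
turns it into \<open>(1, p + 1)\<close>, a letter of the smaller monoid.\<close>

lemma barrier_if_trivial_tail:
  assumes "3 \<le> n" "barrier_dichotomy (n - 1)" "rotating (n - 1) v"
    "trivial_tail n (phi_word n (P @ v))" "P \<in> lists (gens n)" "P \<noteq> []" "last P = (p, n)" "p \<noteq> n - 1"
  shows "contains_barrier n p v"
proof (rule ccontr)
  assume no: "\<not> contains_barrier n p v"
  have p: "1 \<le> p" "p < n"
    using last_in_gens[OF assms(5,6)] assms(7) by (auto simp: gens_def)
  have v: "v \<in> lists (gens (n - 1))"
    using rotating_lists[OF _ assms(3)] assms(1) by simp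
  have n: "n - 1 + 1 = n" using assms(1) by simp
  have "p \<le> r" if rs: "(r, s) \<in> set v" for r s
  proof (cases "p = 1")
    case True
    then show ?thesis using rs v by (auto simp: in_lists_conv_set gens_def)
  next
    case False
    have "v \<noteq> []" using rs by (cases v) auto
    then have "ends_in (n - 1) v"
      using ends_in_if_trivial_tail[OF assms(1) v _ assms(4)] by blast
    moreover have "2 \<le> p" "p < n - 1" using p assms(8) False by auto
    ultimately have "\<forall>(r, s)\<in>set v. p \<le> r"
      using assms(2,3) no n unfolding barrier_dichotomy_def by metis
    then show ?thesis using rs by auto
  qed
  moreover have "(p, n) \<in> gens n" "butlast P \<in> lists (gens n)"
    using p assms(5) by (auto simp: gens_def in_lists_conv_set dest: in_set_butlastD)
  ultimately obtain u where "dual_cong n (butlast P @ [(p, n)] @ v) (u @ [(p, n)])"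
    using push_right[OF v] by blast
  moreover have "butlast P @ [(p, n)] @ v = P @ v"
    using append_butlast_last_id[OF assms(6)] assms(7) by (metis append.assoc)
  ultimately have u: "dual_cong n (P @ v) (u @ [(p, n)])"
    by metis
  then have "P @ v \<in> lists (gens n)"
    using dual_cong_lists by blast
  then show False
    using trivial_tail_phi_iff[OF assms(1)] assms(1,4,8) u by fastforce
qed

text \<open>A right divisor \<open>(i, j)\<close> of \<open>P @ v\<close> with \<open>j \<le> n - 2\<close> would divide \<open>v\<close>, which has trivial tail;
a right divisor \<open>(i, n)\<close> is excluded because its trace would have to be equal to the index of the last
letter of \<open>P\<close>, while it is smaller: because of the barrier, or because \<open>i \<le> n - 2\<close>.\<close>

lemma trivial_tail_if_barrier:
  assumes n: "3 \<le> n" "barrier_dichotomy (n - 1)" and v: "rotating (n - 1) v" "v = [] \<or> ends_in (n - 1) v"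
    and P: "trivial_tail n P"
    and barrier: "P \<noteq> [] \<Longrightarrow> fst (last P) = n - 1 \<or> contains_barrier n (fst (last P)) v"
  shows "trivial_tail n (phi_word n (P @ v))"
proof -
  have vl: "v \<in> lists (gens (n - 1))"
    using rotating_lists[OF _ v(1)] n(1) by simp
  then have "v \<in> lists (gens n)"
    using lists_mono[OF gens_mono[of "n - 1" n]] by auto
  then have Pv: "P @ v \<in> lists (gens n)"
    using P by (simp add: trivial_tail_def)
  have "j = n - 1 \<or> (i = n - 1 \<and> j = n)" if u: "dual_cong n (P @ v) (u @ [(i, j)])" for u i j
  proof (rule ccontr)
    assume not: "\<not> (j = n - 1 \<or> (i = n - 1 \<and> j = n))"
    have ij: "1 \<le> i" "i < j" "j \<le> n"
      using dual_cong_lists[OF u] by (auto simp: gens_def)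
    show False
    proof (cases "j = n")
      case False
      then have g: "(i, j) \<in> gens (n - 1 - 1)"
        using not ij by (auto simp: gens_def)
      then have "[(i, j)] \<in> lists (gens (n - 1))"
        by (auto simp: gens_def)
      then obtain h where h: "dual_cong (n - 1) (h @ [(i, j)]) v"
        using tail_right_divisor[OF P dual_cong.sym[OF u] _ vl] by blast
      then have "v \<noteq> []"
        using dual_cong_length[OF h] by auto
      then have "trivial_tail (n - 1) v"
        using rotating_trivial_tail v n(1) by auto
      then show False
        using g dual_cong.sym[OF h] unfolding trivial_tail_def by blast
    next
      case True
      then have i: "i \<le> n - 2" "dual_cong n (u @ [(i, n)]) (P @ v)"
        using not ij dual_cong.sym[OF u] by auto
      obtain u' where u': "dual_cong n P (u' @ [(trace v i, n)])"
        using trace_divides[OF i(2) vl] by blast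
      then have ne: "P \<noteq> []"
        using dual_cong_length[OF u'] by auto
      have Pl: "P \<in> lists (gens n)"
        using P by (simp add: trivial_tail_def)
      have "dual_cong n P (butlast P @ [(fst (last P), n)])"
        using trivial_tail_last(1)[OF P ne] append_butlast_last_id[OF ne] dual_cong.refl[OF Pl] by simp
      then have t: "trace v i = fst (last P)"
        using trivial_tail_last_unique[OF P u'] by blast
      show False
      proof (cases "fst (last P) = n - 1")
        case True
        then show False using t trace_le[of v i] i(1) n(1) by simp
      next
        case False
        then have b: "contains_barrier n (fst (last P)) v"
          using barrier ne by blast
        then have "2 \<le> fst (last P)" "fst (last P) < n - 1" "ends_in (n - 1) v"
          using v(2) by (auto simp: contains_barrier_def is_barrier_def)
        moreover have "n - 1 + 1 = n" using n(1) by simp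
        ultimately have "trace v (n - 1 - 1) < fst (last P)"
          using n(2) v(1) b unfolding barrier_dichotomy_def by metis
        moreover have "trace v i \<le> trace v (n - 1 - 1)"
          using i(1) by (intro trace_mono) simp
        ultimately show False
          using t by simp
      qed
    qed
  qed
  then show ?thesis
    using trivial_tail_phi_iff[OF n(1) Pv] by blast
qed

lemma phi_concat_take_Suc:
  assumes "i < length ws"
  shows "phi_concat n (take (Suc i) ws) = phi_word n (phi_concat n (take i ws)) @ ws ! i"
  using assms by (simp add: take_Suc_conv_app_nth)

text \<open>Apart from the last entry, only the second one from the right can be empty: the partial product
before an empty entry must end in \<open>(n - 1, n)\<close>, which is rotated to \<open>(1, n)\<close>, and a letter \<open>(1, n)\<close>
can be pushed through the next entry, as there are no barriers for the index 1; so the tail cannot be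
trivial after a further rotation.\<close>

lemma rotating_conditions_if_splitting:
  assumes n: "3 \<le> n" "barrier_dichotomy (n - 1)" and ws: "splitting_words n ws" "\<forall>v\<in>set ws. rotating (n - 1) v"
  shows "rotating_conditions n ws"
proof -
  let ?b = "length ws"
  define P where "P i = phi_word n (phi_concat n (take i ws))" for i
  have l: "ws ! i \<in> lists (gens (n - 1))" "rotating (n - 1) (ws ! i)" if "i < ?b" for i
    using ws that rotating_lists[of "n - 1"] n(1) by auto
  have Pl: "P i \<in> lists (gens n)" for i
    unfolding P_def using ws(1) set_take_subset[of i ws]
    by (intro phi_word_lists phi_concat_lists) (auto simp: splitting_words_def)
  have P_Suc: "P (Suc i) = phi_word n (P i @ ws ! i)" if "i < ?b" for i
    using phi_concat_take_Suc[OF that] by (simp add: P_def)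
  have tail: "trivial_tail n (phi_word n (P i @ ws ! i))" if "i + 1 < ?b" for i
    using ws(1) that P_Suc[of i] by (auto simp: splitting_words_def P_def)
  have P_ne: "P i \<noteq> []" if "1 \<le> i" for i
  proof -
    have "take i ws \<noteq> []" "hd (take i ws) \<noteq> []"
      using that ws(1) by (auto simp: splitting_words_def hd_take)
    then show ?thesis by (simp add: P_def phi_concat_eq_Nil)
  qed
  have ends: "ends_in (n - 1) (ws ! i)" if "i + 1 < ?b" "ws ! i \<noteq> []" for i
    using ends_in_if_trivial_tail[OF n(1) l(1) that(2) tail[OF that(1)]] that(1) by simp
  have barrier: "contains_barrier n p (ws ! i)"
    if "i + 1 < ?b" "1 \<le> i" "last (P i) = (p, n)" "p \<noteq> n - 1" for i p
    using barrier_if_trivial_tail[OF n l(2) tail Pl P_ne] that by simp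
  have empty: "i + 2 = ?b" "1 \<le> i" if i: "i + 1 < ?b" "ws ! i = []" for i
  proof -
    have "ws ! 0 \<noteq> []" using ws(1) by (auto simp: splitting_words_def hd_conv_nth)
    then show i1: "1 \<le> i" using i(2) by (cases i) auto
    have "P i = phi_word n (phi_concat n (take i ws))" by (simp add: P_def)
    have "trivial_tail n (P i)"
      using ws(1) i1 i(1) by (simp add: splitting_words_def P_def)
    then obtain p where p: "last (P i) = (p, n)"
      using trivial_tail_last P_ne[OF i1] by metis
    have "p = n - 1"
      using barrier[OF i(1) i1 p] i(2) by (auto simp: contains_barrier_def)
    then have "last (P (Suc i)) = (1, n)"
      using P_Suc[of i] i last_phi_word[OF P_ne[OF i1], of n] p n(1) by (simp add: phi_letter_def)
    show "i + 2 = ?b"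
    proof (rule ccontr)
      assume "i + 2 \<noteq> ?b"
      then have "contains_barrier n 1 (ws ! (Suc i))"
        using barrier[OF _ _ \<open>last (P (Suc i)) = (1, n)\<close>] i(1) n(1) by simp
      then show False by (auto simp: contains_barrier_def is_barrier_def)
    qed
  qed
  have "ends_in (n - 1) (ws ! i)" if "i + 3 \<le> ?b" for i
    using ends[of i] empty[of i] that by fastforce
  moreover have "ws ! (?b - 2) = [] \<and> ?b \<noteq> 2 \<or> ends_in (n - 1) (ws ! (?b - 2))" if "2 \<le> ?b"
    using ends[of "?b - 2"] empty[of "?b - 2"] that by fastforce
  moreover have "contains_barrier n (fst (last (ws ! i)) + 1) (ws ! (i + 1))"
    if "i + 3 \<le> ?b" "fst (last (ws ! i)) + 1 \<noteq> n - 1" for i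
  proof -
    have e: "ends_in (n - 1) (ws ! i)"
      using ends[of i] empty[of i] that(1) by fastforce
    have "last (P (i + 1)) = (fst (last (ws ! i)) + 1, n)"
      using P_Suc[of i] ends_in_phi[OF e] that(1) n(1) e by (simp add: ends_in_def)
    then show ?thesis
      using barrier[of "i + 1"] that by simp
  qed
  ultimately show ?thesis
    unfolding rotating_conditions_def by blast
qed

lemma splitting_if_rotating_conditions:
  assumes n: "3 \<le> n" "barrier_dichotomy (n - 1)" and ws: "\<forall>v\<in>set ws. rotating (n - 1) v"
    and cond: "rotating_conditions n ws" and b: "2 \<le> length ws"
  shows "splitting_words n ws"
proof -
  let ?b = "length ws"
  have l: "ws ! i \<in> lists (gens (n - 1))" "rotating (n - 1) (ws ! i)" if "i < ?b" for i
    using ws that rotating_lists[of "n - 1"] n(1) by auto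
  have ends: "ends_in (n - 1) (ws ! i)" if "i + 3 \<le> ?b" for i
    using cond that by (auto simp: rotating_conditions_def)
  have ends': "ws ! i = [] \<or> ends_in (n - 1) (ws ! i)" if "i + 1 < ?b" for i
  proof (cases "i + 3 \<le> ?b")
    case False
    then have "i = ?b - 2" using that by simp
    then show ?thesis using cond b by (auto simp: rotating_conditions_def)
  qed (use ends in blast)
  have "ws ! 0 \<noteq> []"
  proof (cases "?b = 2")
    case True
    then show ?thesis using cond by (auto simp: rotating_conditions_def ends_in_def)
  next
    case False
    then show ?thesis using ends[of 0] b by (simp add: ends_in_def)
  qed
  moreover have "trivial_tail n (phi_word n (phi_concat n (take (Suc k) ws)))" if "Suc k < ?b" for k
    using that
  proof (induction k)
    case 0
    moreover have "ws \<noteq> []" using b by auto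
    ultimately show ?case
      using trivial_tail_if_barrier[OF n l(2) ends', of 0 "[]"] phi_concat_take_Suc[of 0 ws n] by simp
  next
    case (Suc k)
    let ?P = "phi_word n (phi_concat n (take (Suc k) ws))"
    have e: "ends_in (n - 1) (ws ! k)" using ends[of k] Suc.prems by simp
    have P: "?P = phi_word n (phi_word n (phi_concat n (take k ws))) @ phi_word n (ws ! k)"
      using phi_concat_take_Suc[of k ws n] Suc.prems by simp
    then have last: "last ?P = (fst (last (ws ! k)) + 1, n)"
      using ends_in_phi[OF e] e n(1) by (simp add: ends_in_def)
    have "k + 3 \<le> ?b" using Suc.prems by simp
    then have "fst (last (ws ! k)) + 1 \<noteq> n - 1 \<longrightarrow>
        contains_barrier n (fst (last (ws ! k)) + 1) (ws ! (k + 1))"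
      using cond unfolding rotating_conditions_def by blast
    then have "fst (last ?P) = n - 1 \<or> contains_barrier n (fst (last ?P)) (ws ! Suc k)"
      unfolding last by auto
    then have "trivial_tail n (phi_word n (?P @ ws ! Suc k))"
      using Suc.IH Suc.prems l(2) ends'[of "Suc k"] by (intro trivial_tail_if_barrier[OF n]) auto
    then show ?case
      using phi_concat_take_Suc[of "Suc k" ws n] Suc.prems by simp
  qed
  then have "trivial_tail n (phi_word n (phi_concat n (take k ws)))" if "1 \<le> k" "k < ?b" for k
    using that by (cases k) auto
  moreover have "set ws \<subseteq> lists (gens (n - 1))"
    using ws rotating_lists[of "n - 1"] n(1) by auto
  moreover have "ws \<noteq> []"
    using b by auto
  ultimately show ?thesis
    unfolding splitting_words_def by (simp add: hd_conv_nth)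
qed

lemma rotating_iff_conditions:
  assumes n: "3 \<le> n" "barrier_dichotomy (n - 1)"
  shows "rotating n w \<longleftrightarrow> (\<exists>ws. ws \<noteq> [] \<and> (\<forall>v\<in>set ws. rotating (n - 1) v) \<and> rotating_conditions n ws \<and>
    w = phi_concat n ws)"
proof
  assume "rotating n w"
  then consider "w = []" | ws where "splitting_words n ws" "\<forall>v\<in>set ws. rotating (n - 1) v" "w = phi_concat n ws"
    using rotating_iff_splitting_words[OF n(1)] by blast
  then show "\<exists>ws. ws \<noteq> [] \<and> (\<forall>v\<in>set ws. rotating (n - 1) v) \<and> rotating_conditions n ws \<and> w = phi_concat n ws"
  proof cases
    case 1
    then show ?thesis
      using rotating_Nil[of "n - 1"] n(1) phi_concat_snoc[of n "[]" "[]"]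
      by (intro exI[of _ "[[]]"]) (simp add: rotating_conditions_def)
  next
    case 2
    then show ?thesis
      using rotating_conditions_if_splitting[OF n] by (auto simp: splitting_words_def)
  qed
next
  assume "\<exists>ws. ws \<noteq> [] \<and> (\<forall>v\<in>set ws. rotating (n - 1) v) \<and> rotating_conditions n ws \<and> w = phi_concat n ws"
  then obtain ws where ws: "ws \<noteq> []" "\<forall>v\<in>set ws. rotating (n - 1) v" "rotating_conditions n ws" "w = phi_concat n ws"
    by blast
  show "rotating n w"
  proof (cases "2 \<le> length ws")
    case True
    then show ?thesis
      using splitting_if_rotating_conditions[OF n ws(2,3)] rotating_iff_splitting_words[OF n(1)] ws by blast
  next
    case False
    then obtain v where v: "ws = [v]"
      using ws(1) by (cases ws) (auto simp: Suc_le_eq)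
    then have "w = v" "v \<in> lists (gens (n - 1))"
      using ws phi_concat_snoc[of n "[]" v] rotating_lists[of "n - 1" v] n(1) by auto
    then have "w = [] \<or> splitting_words n ws"
      using v by (auto simp: splitting_words_def)
    then show ?thesis
      using rotating_iff_splitting_words[OF n(1)] ws by blast
  qed
qed

section \<open>The barrier dichotomy\<close>

lemma trace_phi:
  assumes "v \<in> lists (gens (n - 1))" "1 \<le> n"
  shows "trace (phi_word n v) (Suc i) = Suc (trace v i)"
  using assms
proof (induction v rule: list.induct)
  case (Cons y v)
  then show ?case
    by (cases y) (auto simp: phi_word_def phi_letter_def gens_def)
qed simp

lemma set_phi_word:
  assumes "v \<in> lists (gens (n - 1))" "1 \<le> n"
  shows "set (phi_word n v) = (\<lambda>(r, s). (r + 1, s + 1)) ` set v"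
proof -
  have "phi_letter n x = (\<lambda>(r, s). (r + 1, s + 1)) x" if "x \<in> set v" for x
  proof -
    have "x \<in> gens (n - 1)" using that assms(1) by (simp add: in_lists_conv_set)
    then show ?thesis using assms(2) by (cases x) (auto simp: phi_letter_def gens_def)
  qed
  then show ?thesis
    by (simp add: phi_word_def)
qed

text \<open>Letters of the smaller monoid do not wrap around, so the rotation shifts barriers by one.\<close>

lemma contains_barrier_phi:
  assumes "v \<in> lists (gens (n - 1))" "1 \<le> n" "1 \<le> p"
  shows "contains_barrier (n + 1) p (phi_word n v) \<longleftrightarrow> contains_barrier n (p - 1) v"
proof -
  have "is_barrier (n + 1) p (r + 1, s + 1) \<longleftrightarrow> is_barrier n (p - 1) (r, s)" if "(r, s) \<in> set v" for r s
  proof -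
    have "(r, s) \<in> gens (n - 1)" using that assms(1) by (simp add: in_lists_conv_set)
    then show ?thesis using assms(2,3) by (auto simp: is_barrier_def gens_def)
  qed
  then show ?thesis
    unfolding contains_barrier_def set_phi_word[OF assms(1,2)] by fastforce
qed

text \<open>The last entry of the splitting of \<open>w\<close> is empty, since \<open>w\<close> ends on the last strand; let \<open>v\<close> be the
entry before it. If \<open>v\<close> is the leftmost entry, then \<open>w\<close> is the rotation of \<open>v\<close> and the dichotomy is
inherited from \<open>v\<close>. Otherwise the entry before \<open>v\<close> contributes to \<open>w\<close> a letter \<open>(1, j + 1)\<close> directly in
front of the rotation of \<open>v\<close>. Either \<open>j = n - 1\<close> or \<open>v\<close> contains a barrier for \<open>j\<close>, so that the trace
through the rotation of \<open>v\<close> is at most \<open>j + 1\<close> and that letter drags it down to 1. The second alternative of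
the dichotomy is then impossible: if there is no barrier for \<open>p\<close>, then \<open>(1, j + 1)\<close> lies
to the left of \<open>p\<close>, so \<open>v\<close> contains a barrier for \<open>j\<close>, hence a letter which starts to the left of
\<open>p - 1\<close>, and by induction \<open>v\<close> contains a barrier for \<open>p - 1\<close>, whose rotation is a barrier for \<open>p\<close>.\<close>

lemma barrier_dichotomy_step:
  assumes n: "3 \<le> n" "barrier_dichotomy (n - 1)"
  shows "barrier_dichotomy n"
proof -
  have "if contains_barrier (n + 1) p w then trace w (n - 1) < p else (\<forall>(r, s)\<in>set w. p \<le> r)"
    if w: "rotating n w" "ends_in n w" and p: "2 \<le> p" "p < n" for w p
  proof -
    obtain ws where ws: "splitting_words n ws" "\<forall>v\<in>set ws. rotating (n - 1) v" "w = phi_concat n ws"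
      using rotating_iff_splitting_words[OF n(1), of w] w by (auto simp: ends_in_def)
    have cond: "rotating_conditions n ws"
      by (rule rotating_conditions_if_splitting[OF n ws(1,2)])
    obtain us x where us: "ws = us @ [x]"
      using ws(1) by (cases ws rule: rev_cases) (auto simp: splitting_words_def)
    have l: "v \<in> lists (gens (n - 1))" if "v \<in> set ws" for v
      using rotating_lists ws(2) that n(1) by auto
    have "x = []"
    proof (rule ccontr)
      assume "x \<noteq> []"
      then have "last w \<in> gens (n - 1)"
        using last_in_gens[OF l, of x] ws(3) us by simp
      then show False
        using w(2) n(1) by (auto simp: ends_in_def gens_def)
    qed
    then have w_us: "w = phi_word n (phi_concat n us)" using ws(3) us by simp
    then obtain us' v where us': "us = us' @ [v]"
      using w(2) by (cases us rule: rev_cases) (auto simp: ends_in_def)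
    have v: "rotating (n - 1) v" "v \<in> lists (gens (n - 1))"
      using ws(2) l us us' by auto
    have w_v: "w = phi_word n (phi_word n (phi_concat n us')) @ phi_word n v"
      using w_us us' by simp
    have nth_v: "ws ! (length ws - 2) = v"
      using us us' by (simp add: nth_append)
    have v_dich: "if contains_barrier n q v then trace v (n - 2) < q else (\<forall>(r, s)\<in>set v. q \<le> r)"
      if "v \<noteq> []" "2 \<le> q" "q < n - 1" for q
    proof -
      have "ends_in (n - 1) v"
        using cond nth_v us us' that(1) by (auto simp: rotating_conditions_def)
      then have "if contains_barrier (n - 1 + 1) q v then trace v (n - 1 - 1) < q
          else (\<forall>(r, s)\<in>set v. q \<le> r)"
        using n(2) v(1) that(2,3) unfolding barrier_dichotomy_def by blast
      moreover have "n - 1 + 1 = n" "n - 1 - 1 = n - 2"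
        using n(1) by simp_all
      ultimately show ?thesis
        by (simp only:)
    qed
    have v_trace: "trace (phi_word n v) (n - 1) = Suc (trace v (n - 2))"
      using trace_phi[OF v(2), of "n - 2"] n(1) by (simp add: numeral_2_eq_2 Suc_diff_Suc)
    have v_set: "set (phi_word n v) = (\<lambda>(r, s). (r + 1, s + 1)) ` set v"
      using set_phi_word[OF v(2)] n(1) by simp
    have v_barrier: "contains_barrier (n + 1) p (phi_word n v) \<longleftrightarrow> contains_barrier n (p - 1) v"
      using contains_barrier_phi[OF v(2)] n(1) p by simp
    show ?thesis
    proof (cases "us' = []")
      case True
      then have wv: "w = phi_word n v" using w_v by simp
      then have "v \<noteq> []" using w(2) by (auto simp: ends_in_def)
      show ?thesis
      proof (cases "p = 2")
        case True
        then have "\<not> contains_barrier n (p - 1) v"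
          by (auto simp: contains_barrier_def is_barrier_def)
        moreover have "\<forall>(r, s)\<in>set w. p \<le> r"
          using True v(2) unfolding wv v_set by (auto simp: in_lists_conv_set gens_def)
        ultimately show ?thesis
          using wv v_barrier by simp
      next
        case False
        then have "2 \<le> p - 1" "p - 1 < n - 1" using p by simp_all
        note dich = v_dich[OF \<open>v \<noteq> []\<close> this]
        show ?thesis
        proof (cases "contains_barrier n (p - 1) v")
          case True
          then have "trace v (n - 2) < p - 1" using dich by simp
          then have "trace w (n - 1) < p" unfolding wv v_trace by simp
          then show ?thesis using True v_barrier wv by simp
        next
          case False
          then have "\<forall>(r, s)\<in>set v. p - 1 \<le> r" using dich by simp
          then have "\<forall>(r, s)\<in>set w. p \<le> r" unfolding wv v_set by fastforce
          then show ?thesis using False v_barrier wv by simp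
        qed
      qed
    next
      case False
      then obtain xs y where xs: "us' = xs @ [y]"
        by (cases us' rule: rev_cases) auto
      have b: "length ws = length xs + 3" "ws ! length xs = y" "ws ! (length xs + 1) = v"
        using us us' xs by (auto simp: nth_append)
      define j where "j = fst (last y) + 1"
      have y: "ends_in (n - 1) y" and j_barrier: "j \<noteq> n - 1 \<Longrightarrow> contains_barrier n j v"
      proof -
        have "length xs + 3 \<le> length ws" using b(1) by simp
        then have "ends_in (n - 1) (ws ! length xs)"
          "fst (last (ws ! length xs)) + 1 \<noteq> n - 1 \<longrightarrow>
            contains_barrier n (fst (last (ws ! length xs)) + 1) (ws ! (length xs + 1))"
          using cond unfolding rotating_conditions_def by blast+
        then show "ends_in (n - 1) y" "j \<noteq> n - 1 \<Longrightarrow> contains_barrier n j v"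
          unfolding b(2,3) j_def by blast+
      qed
      have y_gens: "last y \<in> gens (n - 1)"
        using last_in_gens[OF l] y us us' xs by (auto simp: ends_in_def)
      then have j: "2 \<le> j" "j \<le> n - 1"
        using y by (auto simp: j_def gens_def ends_in_def)
      have "phi_word n y = butlast (phi_word n y) @ [(j, n)]"
        using ends_in_phi[OF y] n(1) y append_butlast_last_id[of "phi_word n y"] by (simp add: j_def ends_in_def)
      then have "phi_word n (phi_word n y) = phi_word n (butlast (phi_word n y) @ [(j, n)])"
        by (rule arg_cong)
      moreover have "phi_word n [(j, n)] = [(1, j + 1)]"
        by (simp add: phi_word_def phi_letter_def)
      ultimately have "phi_word n (phi_word n y) = phi_word n (butlast (phi_word n y)) @ [(1, j + 1)]"
        by simp
      then have "w = (phi_word n (phi_word n (phi_word n (phi_concat n xs))) @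
          phi_word n (butlast (phi_word n y))) @ [(1, j + 1)] @ phi_word n v"
        using w_v xs by simp
      then obtain Z where Z: "w = Z @ [(1, j + 1)] @ phi_word n v" ..
      show ?thesis
      proof (cases "contains_barrier (n + 1) p w")
        case True
        have "trace (phi_word n v) (n - 1) \<le> j + 1"
        proof (cases "j = n - 1")
          case True
          then show ?thesis using trace_le[of "phi_word n v" "n - 1"] by simp
        next
          case False
          then have bj: "contains_barrier n j v" by (rule j_barrier)
          then have "v \<noteq> []" by (auto simp: contains_barrier_def)
          then have "trace v (n - 2) < j"
            using v_dich[of j] bj j False by simp
          then show ?thesis using v_trace by simp
        qed
        then have "trace ([(1, j + 1)] @ phi_word n v) (n - 1) \<le> 1"
          by simp
        then have "trace w (n - 1) \<le> 1"
          unfolding Z trace_simps(2)[of Z] using trace_le[of Z] by (rule order_trans[rotated])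
        then show ?thesis using p True by simp
      next
        case False
        have no: "\<not> (r < p \<and> p < s \<and> s \<le> n)" if "(r, s) \<in> set w" "1 \<le> r" for r s
          using False that by (auto simp: contains_barrier_def is_barrier_def)
        have "j + 1 \<le> p"
          using no[of 1 "j + 1"] Z p j by auto
        then have bj: "contains_barrier n j v"
          using j_barrier p by simp
        then obtain r s where rs: "(r, s) \<in> set v" "r < j"
          by (auto simp: contains_barrier_def is_barrier_def)
        then have "v \<noteq> []" by (cases v) auto
        have "\<not> contains_barrier (n + 1) p (phi_word n v)"
          using False Z by (auto simp: contains_barrier_def)
        then have "\<forall>(r, s)\<in>set v. p - 1 \<le> r"
          using v_dich[OF \<open>v \<noteq> []\<close>, of "p - 1"] v_barrier \<open>j + 1 \<le> p\<close> j p by simp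
        then have False
          using rs \<open>j + 1 \<le> p\<close> by auto
        then show ?thesis ..
      qed
    qed
  qed
  then show ?thesis
    unfolding barrier_dichotomy_def by blast
qed

lemma barrier_dichotomy_all:
  assumes "2 \<le> n"
  shows "barrier_dichotomy n"
  using assms
proof (induction n rule: dec_induct)
  case base
  show ?case by (simp add: barrier_dichotomy_def)
next
  case (step n)
  then show ?case using barrier_dichotomy_step[of "Suc n"] by simp
qed

section \<open>The characterisation of rotating words\<close>

lemma ends_in_iff:
  assumes "v \<in> lists (gens m)"
  shows "(\<exists>p\<in>{2..m}. ends_with v (p - 1, m)) \<longleftrightarrow> ends_in m v"
proof
  assume "ends_in m v"
  moreover then have "last v \<in> gens m"
    using last_in_gens[OF assms] by (simp add: ends_in_def)
  ultimately show "\<exists>p\<in>{2..m}. ends_with v (p - 1, m)"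
    by (intro bexI[of _ "fst (last v) + 1"]) (auto simp: ends_with_def ends_in_def gens_def prod_eq_iff)
qed (auto simp: ends_with_def ends_in_def)

lemma all_entry_iff:
  "(\<forall>k. 3 \<le> k \<and> k \<le> length ws \<longrightarrow> Q (entry ws k) (entry ws (k - 1))) \<longleftrightarrow>
    (\<forall>i. i + 3 \<le> length ws \<longrightarrow> Q (ws ! i) (ws ! (i + 1)))"
proof (intro iffI allI impI)
  fix i assume *: "\<forall>k. 3 \<le> k \<and> k \<le> length ws \<longrightarrow> Q (entry ws k) (entry ws (k - 1))" "i + 3 \<le> length ws"
  have "3 \<le> length ws - i \<and> length ws - i \<le> length ws" using *(2) by simp
  with *(1) have "Q (entry ws (length ws - i)) (entry ws (length ws - i - 1))" by blast
  then show "Q (ws ! i) (ws ! (i + 1))"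
    using *(2) by (simp add: entry_def)
next
  fix k assume *: "\<forall>i. i + 3 \<le> length ws \<longrightarrow> Q (ws ! i) (ws ! (i + 1))" "3 \<le> k \<and> k \<le> length ws"
  then have "Q (ws ! (length ws - k)) (ws ! (length ws - k + 1))" by auto
  moreover have "length ws - (k - 1) = length ws - k + 1" using *(2) by auto
  ultimately show "Q (entry ws k) (entry ws (k - 1))"
    by (simp add: entry_def)
qed

lemma rotating_conditions_iff:
  assumes "set ws \<subseteq> lists (gens (n - 1))"
  shows "rotating_conditions n ws \<longleftrightarrow>
      (\<forall>k. 3 \<le> k \<and> k \<le> length ws \<longrightarrow>
        (\<exists>p\<in>{2..n - 1}. ends_with (entry ws k) (p - 1, n - 1))) \<and>
      (2 \<le> length ws \<longrightarrow>
        (entry ws 2 = [] \<and> length ws \<noteq> 2) \<or>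
        (\<exists>p\<in>{2..n - 1}. ends_with (entry ws 2) (p - 1, n - 1))) \<and>
      (\<forall>k. 3 \<le> k \<and> k \<le> length ws \<longrightarrow>
        (\<forall>p\<in>{2..n - 1}. ends_with (entry ws k) (p - 1, n - 1) \<and> p \<noteq> n - 1 \<longrightarrow>
          contains_barrier n p (entry ws (k - 1))))"
proof -
  let ?E = "\<lambda>v. \<exists>p\<in>{2..n - 1}. ends_with v (p - 1, n - 1)"
  let ?B = "\<lambda>v v'. \<forall>p\<in>{2..n - 1}. ends_with v (p - 1, n - 1) \<and> p \<noteq> n - 1 \<longrightarrow> contains_barrier n p v'"
  have E: "?E v \<longleftrightarrow> ends_in (n - 1) v" if "v \<in> set ws" for v
    using ends_in_iff assms that by blast
  have 1: "(\<forall>k. 3 \<le> k \<and> k \<le> length ws \<longrightarrow> ?E (entry ws k)) \<longleftrightarrow>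
      (\<forall>i. i + 3 \<le> length ws \<longrightarrow> ends_in (n - 1) (ws ! i))"
    unfolding all_entry_iff[of ws "\<lambda>v _. ?E v"] using E by auto
  have 2: "(2 \<le> length ws \<longrightarrow> (entry ws 2 = [] \<and> length ws \<noteq> 2) \<or> ?E (entry ws 2)) \<longleftrightarrow>
    (2 \<le> length ws \<longrightarrow> ws ! (length ws - 2) = [] \<and> length ws \<noteq> 2 \<or> ends_in (n - 1) (ws ! (length ws - 2)))"
    using E[of "entry ws 2"] entry_in_set[of 2 ws] by (auto simp: entry_def)
  have B: "?B v v' \<longleftrightarrow> (fst (last v) + 1 \<noteq> n - 1 \<longrightarrow> contains_barrier n (fst (last v) + 1) v')"
    if "v \<in> set ws" "ends_in (n - 1) v" for v v'
  proof -
    have "last v \<in> gens (n - 1)"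
      using last_in_gens[of v "n - 1"] assms that by (auto simp: ends_in_def)
    then have "fst (last v) + 1 \<in> {2..n - 1}" "ends_with v (fst (last v) + 1 - 1, n - 1)"
      using that(2) by (auto simp: ends_in_def ends_with_def gens_def prod_eq_iff)
    moreover have "p = fst (last v) + 1" if "p \<in> {2..n - 1}" "ends_with v (p - 1, n - 1)" for p
      using that by (auto simp: ends_with_def)
    ultimately show ?thesis by blast
  qed
  have 3: "(\<forall>k. 3 \<le> k \<and> k \<le> length ws \<longrightarrow> ?B (entry ws k) (entry ws (k - 1))) \<longleftrightarrow>
      (\<forall>i. i + 3 \<le> length ws \<longrightarrow> fst (last (ws ! i)) + 1 \<noteq> n - 1 \<longrightarrow>
        contains_barrier n (fst (last (ws ! i)) + 1) (ws ! (i + 1)))"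
    if "\<forall>i. i + 3 \<le> length ws \<longrightarrow> ends_in (n - 1) (ws ! i)"
    unfolding all_entry_iff[of ws ?B] using B that by auto
  show ?thesis
    unfolding rotating_conditions_def 1 2 using 3 by blast
qed

theorem theorem4p11:
  fixes n :: nat and w :: word
  assumes "3 \<le> n" and "w \<in> lists (gens n)"
  shows "rotating n w \<longleftrightarrow>
    (\<exists>(b::nat) (ws::word list).
      1 \<le> b \<and> length ws = b \<and> set ws \<subseteq> lists (gens (n - 1)) \<and>
      w = phi_concat n ws \<and>
      (\<forall>k. 1 \<le> k \<and> k \<le> b \<longrightarrow> rotating (n - 1) (entry ws k)) \<and>
      (\<forall>k. 3 \<le> k \<and> k \<le> b \<longrightarrow>
        (\<exists>p\<in>{2..n - 1}. ends_with (entry ws k) (p - 1, n - 1))) \<and>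
      (2 \<le> b \<longrightarrow>
        (entry ws 2 = [] \<and> b \<noteq> 2) \<or>
        (\<exists>p\<in>{2..n - 1}. ends_with (entry ws 2) (p - 1, n - 1))) \<and>
      (\<forall>k. 3 \<le> k \<and> k \<le> b \<longrightarrow>
        (\<forall>p\<in>{2..n - 1}. ends_with (entry ws k) (p - 1, n - 1) \<and> p \<noteq> n - 1 \<longrightarrow>
          contains_barrier n p (entry ws (k - 1)))))"
  (is "_ \<longleftrightarrow> (\<exists>b ws. 1 \<le> b \<and> length ws = b \<and> set ws \<subseteq> _ \<and> _ \<and> ?i b ws \<and> ?ii b ws \<and> ?iii b ws \<and> ?iv b ws)")
proof -
  have entries: "?i (length ws) ws \<longleftrightarrow> (\<forall>v\<in>set ws. rotating (n - 1) v)" for ws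
  proof
    assume i: "?i (length ws) ws"
    show "\<forall>v\<in>set ws. rotating (n - 1) v"
    proof
      fix v assume "v \<in> set ws"
      then obtain i where "i < length ws" "v = ws ! i" by (metis in_set_conv_nth)
      then have "v = entry ws (length ws - i)" "1 \<le> length ws - i" by (simp_all add: entry_def)
      then show "rotating (n - 1) v" using i by simp
    qed
  qed (simp add: entry_in_set)
  have lists: "set ws \<subseteq> lists (gens (n - 1))" if "\<forall>v\<in>set ws. rotating (n - 1) v" for ws
    using that rotating_lists[of "n - 1"] assms(1) by auto
  have "rotating n w \<longleftrightarrow> (\<exists>ws. ws \<noteq> [] \<and> (\<forall>v\<in>set ws. rotating (n - 1) v) \<and> rotating_conditions n ws \<and>
      w = phi_concat n ws)"
    using rotating_iff_conditions barrier_dichotomy_all assms(1) by simp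
  also have "\<dots> \<longleftrightarrow> (\<exists>ws. 1 \<le> length ws \<and> set ws \<subseteq> lists (gens (n - 1)) \<and> w = phi_concat n ws \<and>
      ?i (length ws) ws \<and> ?ii (length ws) ws \<and> ?iii (length ws) ws \<and> ?iv (length ws) ws)"
    (is "_ \<longleftrightarrow> (\<exists>ws. ?R ws)")
  proof (intro iff_exI)
    fix ws :: "word list"
    have ne: "ws \<noteq> [] \<longleftrightarrow> 1 \<le> length ws" by (cases ws) auto
    show "ws \<noteq> [] \<and> (\<forall>v\<in>set ws. rotating (n - 1) v) \<and> rotating_conditions n ws \<and> w = phi_concat n ws \<longleftrightarrow> ?R ws"
      unfolding entries ne using rotating_conditions_iff[of ws n] lists[of ws] by blast
  qed
  finally show ?thesis by blast
qed

end
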